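(* Let $n\ge 1$ and let ${}^{B}\Lambda_n^-\subset \mathrm{Pol}_n^-$ be the ring of spin type B symmetric polynomials. Then ${}^{B}\Lambda_n^-=\mathbb{Z}[x_1^2,\dots,x_n^2]^{S_n}$, and this is a polynomial algebra generated by ${}^{B}\varepsilon_1^-,{}^{B}\varepsilon_2^-,\dots,{}^{B}\varepsilon_n^-$.
   Context: $\mathrm{Pol}_n^-$ is the unital $\mathbb{Z}$-algebra generated by $x_1,\dots,x_n$ subject to $x_ix_j+x_jx_i=0$ for all $i\ne j$. The elements $x_1^2,\dots,x_n^2$ commute; $\mathbb{Z}[x_1^2,\dots,x_n^2]$ is the subalgebra they generate, and $S_n$ acts on it by permuting the $x_i^2$. For $1\le i\le n-1$ let $s_i$ be the algebra endomorphism of $\mathrm{Pol}_n^-$ with $s_i(x_i)=-x_{i+1}$, $s_i(x_{i+1})=-x_i$, $s_i(x_j)=-x_j$ for $j\ne i,i+1$, and let $s_n^B$ be the algebra endomorphism with $s_n^B(x_j)=-x_j$ for all $j$. The type B odd Demazure operators are the $\mathbb{Z}$-linear operators $\partial_i^-$ ($1\le i\le n-1$) and $\partial_n^B$ on $\mathrm{Pol}_n^-$ that kill $1$ and satisfy: $\partial_i^-(x_j)=1$ if $j\in\{i,i+1\}$ and $0$ otherwise; $\partial_n^B(x_j)=1$ if $j=n$ and $0$ otherwise; and $\partial_i^-(fg)=\partial_i^-(f)g+s_i(f)\partial_i^-(g)$, $\partial_n^B(fg)=\partial_n^B(f)g+s_n^B(f)\partial_n^B(g)$ for all $f,g$. The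 ring of spin type B symmetric polynomials is ${}^{B}\Lambda_n^-=\bigcap_{i=1}^{n-1}\ker(\partial_i^-)\cap\ker(\partial_n^B)$ (equivalently the intersection of the images of these operators). The spin type B elementary symmetric functions are ${}^{B}\varepsilon_k^-=\sum_{1\le i_1<\dots<i_k\le n}x_{i_1}^2\cdots x_{i_k}^2$ for $1\le k\le n$. *)

theory Defs
  imports "HOL-Algebra.Algebra" "HOL-Library.Poly_Mapping" "HOL-Combinatorics.Permutations"
begin

text \<open>
  Lists under concatenation are the free monoid, so that finitely supported maps
  from \<^typ>\<open>nat list\<close> to \<^typ>\<open>int\<close>, with the convolution product of
  \<^theory>\<open>HOL-Library.Poly_Mapping\<close>, form a free associative \<open>\<int>\<close>-algebra.
\<close>

instantiation list :: (type) monoid_add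
begin

definition zero_list :: "'a list" where
  "zero_list = []"

definition plus_list :: "'a list \<Rightarrow> 'a list \<Rightarrow> 'a list" where
  "plus_list xs ys = xs @ ys"

instance
  by standard (simp_all add: zero_list_def plus_list_def)

end

definition free_alg :: "nat \<Rightarrow> (nat list \<Rightarrow>\<^sub>0 int) ring" where
  "free_alg n = \<lparr>carrier = {p. Poly_Mapping.keys p \<subseteq> lists {1..n}},
     monoid.mult = (*), one = 1, ring.zero = 0, ring.add = (+)\<rparr>"

definition free_gen :: "nat \<Rightarrow> (nat list \<Rightarrow>\<^sub>0 int)" where
  "free_gen i = Poly_Mapping.single [i] 1"

lemma ring_free_alg: "ring (free_alg n)"
proof (rule ringI)
  show "abelian_group (free_alg n)"
  proof (rule abelian_groupI)
    fix x y assume "x \<in> carrier (free_alg n)" "y \<in> carrier (free_alg n)"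
    then show "x \<oplus>\<^bsub>free_alg n\<^esub> y \<in> carrier (free_alg n)"
      using Poly_Mapping.keys_add[of x y] by (auto simp: free_alg_def)
  next
    fix x assume "x \<in> carrier (free_alg n)"
    then show "\<exists>y\<in>carrier (free_alg n). y \<oplus>\<^bsub>free_alg n\<^esub> x = \<zero>\<^bsub>free_alg n\<^esub>"
      by (intro bexI[of _ "- x"]) (auto simp: free_alg_def)
  qed (auto simp: free_alg_def ac_simps)
  show "monoid (free_alg n)"
  proof (rule monoidI)
    fix x y assume "x \<in> carrier (free_alg n)" "y \<in> carrier (free_alg n)"
    then show "x \<otimes>\<^bsub>free_alg n\<^esub> y \<in> carrier (free_alg n)"
      using Poly_Mapping.keys_mult[of x y] by (fastforce simp: free_alg_def plus_list_def)
  qed (auto simp: free_alg_def zero_list_def mult.assoc)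
qed (auto simp: free_alg_def algebra_simps)

lemma free_gen_closed: "i \<in> {1..n} \<Longrightarrow> free_gen i \<in> carrier (free_alg n)"
  by (auto simp: free_gen_def free_alg_def)


definition odd_rels :: "nat \<Rightarrow> (nat list \<Rightarrow>\<^sub>0 int) set" where
  "odd_rels n = {free_gen i * free_gen j + free_gen j * free_gen i | i j.
     i \<in> {1..n} \<and> j \<in> {1..n} \<and> i \<noteq> j}"

definition odd_ideal :: "nat \<Rightarrow> (nat list \<Rightarrow>\<^sub>0 int) set" where
  "odd_ideal n = Idl\<^bsub>free_alg n\<^esub> (odd_rels n)"

definition odd_pol :: "nat \<Rightarrow> (nat list \<Rightarrow>\<^sub>0 int) set ring" where
  "odd_pol n = free_alg n Quot odd_ideal n"

definition odd_var :: "nat \<Rightarrow> nat \<Rightarrow> (nat list \<Rightarrow>\<^sub>0 int) set" where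
  "odd_var n i = odd_ideal n +>\<^bsub>free_alg n\<^esub> free_gen i"

lemma ideal_odd_ideal: "ideal (odd_ideal n) (free_alg n)"
proof -
  interpret ring "free_alg n" by (rule ring_free_alg)
  have "odd_rels n \<subseteq> carrier (free_alg n)"
  proof
    fix p assume "p \<in> odd_rels n"
    then obtain i j where ij: "i \<in> {1..n}" "j \<in> {1..n}"
      and p: "p = free_gen i \<otimes>\<^bsub>free_alg n\<^esub> free_gen j \<oplus>\<^bsub>free_alg n\<^esub> free_gen j \<otimes>\<^bsub>free_alg n\<^esub> free_gen i"
      by (auto simp: odd_rels_def free_alg_def)
    show "p \<in> carrier (free_alg n)"
      unfolding p using ij by (intro a_closed m_closed free_gen_closed)
  qed
  then show ?thesis
    unfolding odd_ideal_def by (rule genideal_ideal)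
qed

lemma ring_odd_pol: "ring (odd_pol n)"
  unfolding odd_pol_def by (rule ideal.quotient_is_ring[OF ideal_odd_ideal])

lemma odd_var_closed: "i \<in> {1..n} \<Longrightarrow> odd_var n i \<in> carrier (odd_pol n)"
  using free_gen_closed[of i n]
  by (auto simp: odd_var_def odd_pol_def FactRing_def A_RCOSETS_def' a_r_coset_def')


text \<open>
  The maps below are determined by their defining properties on the carrier;
  membership in \<^const>\<open>extensional\<close> fixes their values elsewhere, so that the
  definite descriptions are meaningful.
\<close>

definition alg_endo ::
    "nat \<Rightarrow> (nat \<Rightarrow> (nat list \<Rightarrow>\<^sub>0 int) set) \<Rightarrow> (nat list \<Rightarrow>\<^sub>0 int) set \<Rightarrow> (nat list \<Rightarrow>\<^sub>0 int) set" where
  "alg_endo n v = (THE \<phi>. \<phi> \<in> extensional (carrier (odd_pol n)) \<and>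
     \<phi> \<in> ring_hom (odd_pol n) (odd_pol n) \<and>
     (\<forall>j\<in>{1..n}. \<phi> (odd_var n j) = v j))"

definition odd_s :: "nat \<Rightarrow> nat \<Rightarrow> (nat list \<Rightarrow>\<^sub>0 int) set \<Rightarrow> (nat list \<Rightarrow>\<^sub>0 int) set" where
  "odd_s n i = alg_endo n (\<lambda>j. \<ominus>\<^bsub>odd_pol n\<^esub>
     odd_var n (if j = i then i + 1 else if j = i + 1 then i else j))"

definition odd_sB :: "nat \<Rightarrow> (nat list \<Rightarrow>\<^sub>0 int) set \<Rightarrow> (nat list \<Rightarrow>\<^sub>0 int) set" where
  "odd_sB n = alg_endo n (\<lambda>j. \<ominus>\<^bsub>odd_pol n\<^esub> odd_var n j)"

text \<open>
  The \<open>\<int>\<close>-linear operator killing \<open>1\<close>, with value \<open>1\<close> on the \<open>x\<^sub>j\<close> with \<open>j \<in> J\<close>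
  and \<open>0\<close> on the other generators, and satisfying the Leibniz rule twisted by \<open>s\<close>.
  Over \<open>\<int>\<close>, linear means additive.
\<close>

definition twisted_derivation ::
    "nat \<Rightarrow> ((nat list \<Rightarrow>\<^sub>0 int) set \<Rightarrow> (nat list \<Rightarrow>\<^sub>0 int) set) \<Rightarrow> nat set \<Rightarrow>
     (nat list \<Rightarrow>\<^sub>0 int) set \<Rightarrow> (nat list \<Rightarrow>\<^sub>0 int) set" where
  "twisted_derivation n s J = (THE D.
     D \<in> extensional (carrier (odd_pol n)) \<and>
     D \<in> hom (add_monoid (odd_pol n)) (add_monoid (odd_pol n)) \<and>
     D \<one>\<^bsub>odd_pol n\<^esub> = \<zero>\<^bsub>odd_pol n\<^esub> \<and>
     (\<forall>j\<in>{1..n}. D (odd_var n j) = (if j \<in> J then \<one>\<^bsub>odd_pol n\<^esub> else \<zero>\<^bsub>odd_pol n\<^esub>)) \<and>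
     (\<forall>f\<in>carrier (odd_pol n). \<forall>g\<in>carrier (odd_pol n).
        D (f \<otimes>\<^bsub>odd_pol n\<^esub> g) =
          D f \<otimes>\<^bsub>odd_pol n\<^esub> g \<oplus>\<^bsub>odd_pol n\<^esub> s f \<otimes>\<^bsub>odd_pol n\<^esub> D g))"

definition odd_demazure :: "nat \<Rightarrow> nat \<Rightarrow> (nat list \<Rightarrow>\<^sub>0 int) set \<Rightarrow> (nat list \<Rightarrow>\<^sub>0 int) set" where
  "odd_demazure n i = twisted_derivation n (odd_s n i) {i, i + 1}"

definition odd_demazureB :: "nat \<Rightarrow> (nat list \<Rightarrow>\<^sub>0 int) set \<Rightarrow> (nat list \<Rightarrow>\<^sub>0 int) set" where
  "odd_demazureB n = twisted_derivation n (odd_sB n) {n}"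

text \<open>For \<open>n = 1\<close> the intersection over \<open>i\<close> is empty, i.e. all of the type; the other kernel
  keeps the result inside the carrier.\<close>

definition spinB_sym :: "nat \<Rightarrow> (nat list \<Rightarrow>\<^sub>0 int) set set" where
  "spinB_sym n =
     (\<Inter>i\<in>{1..<n}. a_kernel (odd_pol n) (odd_pol n) (odd_demazure n i)) \<inter>
     a_kernel (odd_pol n) (odd_pol n) (odd_demazureB n)"


definition sq_var :: "nat \<Rightarrow> nat \<Rightarrow> (nat list \<Rightarrow>\<^sub>0 int) set" where
  "sq_var n i = odd_var n i [^]\<^bsub>odd_pol n\<^esub> (2::nat)"

definition sq_subalg :: "nat \<Rightarrow> (nat list \<Rightarrow>\<^sub>0 int) set ring" where
  "sq_subalg n = odd_pol n \<lparr>carrier := generate_ring (odd_pol n) (sq_var n ` {1..n})\<rparr>"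

definition sq_action ::
    "nat \<Rightarrow> (nat \<Rightarrow> nat) \<Rightarrow> (nat list \<Rightarrow>\<^sub>0 int) set \<Rightarrow> (nat list \<Rightarrow>\<^sub>0 int) set" where
  "sq_action n \<sigma> = (THE \<phi>. \<phi> \<in> extensional (carrier (sq_subalg n)) \<and>
     \<phi> \<in> ring_hom (sq_subalg n) (sq_subalg n) \<and>
     (\<forall>i\<in>{1..n}. \<phi> (sq_var n i) = sq_var n (\<sigma> i)))"

definition sq_invariants :: "nat \<Rightarrow> (nat list \<Rightarrow>\<^sub>0 int) set set" where
  "sq_invariants n =
     {f \<in> carrier (sq_subalg n). \<forall>\<sigma>. \<sigma> permutes {1..n} \<longrightarrow> sq_action n \<sigma> f = f}"

text \<open>Index sets \<open>i\<^sub>1 < \<dots> < i\<^sub>k\<close> are \<open>k\<close>-element subsets, and the factors are multiplied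
  in increasing order of the index.\<close>

definition spinB_elem :: "nat \<Rightarrow> nat \<Rightarrow> (nat list \<Rightarrow>\<^sub>0 int) set" where
  "spinB_elem n k = (\<Oplus>\<^bsub>odd_pol n\<^esub> S \<in> {S. S \<subseteq> {1..n} \<and> card S = k}.
     foldr (\<lambda>i p. sq_var n i \<otimes>\<^bsub>odd_pol n\<^esub> p) (sorted_list_of_set S) \<one>\<^bsub>odd_pol n\<^esub>)"


text \<open>The polynomial ring \<open>\<int>[t\<^sub>1, \<dots>, t\<^sub>n]\<close>: monomials are exponent vectors
  \<^typ>\<open>nat \<Rightarrow>\<^sub>0 nat\<close> supported in \<open>{1..n}\<close>.\<close>

definition int_mpoly_ring :: "nat \<Rightarrow> ((nat \<Rightarrow>\<^sub>0 nat) \<Rightarrow>\<^sub>0 int) ring" where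
  "int_mpoly_ring n =
     \<lparr>carrier = {p. \<forall>m\<in>Poly_Mapping.keys p. Poly_Mapping.keys m \<subseteq> {1..n}},
      monoid.mult = (*), one = 1, ring.zero = 0, ring.add = (+)\<rparr>"

definition mpoly_var :: "nat \<Rightarrow> ((nat \<Rightarrow>\<^sub>0 nat) \<Rightarrow>\<^sub>0 int)" where
  "mpoly_var k = Poly_Mapping.single (Poly_Mapping.single k 1) 1"

definition is_polynomial_algebra_on ::
    "('a, 'b) ring_scheme \<Rightarrow> nat \<Rightarrow> (nat \<Rightarrow> 'a) \<Rightarrow> bool" where
  "is_polynomial_algebra_on R n e \<longleftrightarrow>
     (\<exists>\<phi> \<in> ring_iso (int_mpoly_ring n) R. \<forall>k\<in>{1..n}. \<phi> (mpoly_var k) = e k)"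

end

theory Submission
  imports Defs
begin

text \<open>
The quotient of the free algebra by the relations \<open>x\<^sub>i x\<^sub>j + x\<^sub>j x\<^sub>i = 0\<close> has the monomials with
increasing indices as a basis.  It is therefore isomorphic to an explicit algebra on integer
combinations of exponents, where \<open>x\<^sup>a x\<^sup>b\<close> is \<open>x\<^sup>a\<^sup>+\<^sup>b\<close> up to the sign of the necessary exchanges
(\<open>to_skew_iso\<close>).  On this side the endomorphisms \<open>s\<^sub>i\<close>, \<open>s\<^sub>n\<^sup>B\<close> and the Demazure operators exist
because their prescriptions on words respect the relations, and they are determined by their values
on the variables (\<open>alg_endo_to_skew\<close>, \<open>twisted_derivation_to_skew\<close>).

The kernels are computed from the commutator formulas
\<open>(x\<^sub>i\<^sub>+\<^sub>1\<^sup>2 - x\<^sub>i\<^sup>2) \<partial>\<^sub>i(f) = (x\<^sub>i\<^sub>+\<^sub>1 - x\<^sub>i) f - s\<^sub>i(f) (x\<^sub>i\<^sub>+\<^sub>1 - x\<^sub>i)\<close> and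
\<open>2 x\<^sub>n\<^sup>2 \<partial>\<^sub>n\<^sup>B(f) = x\<^sub>n f - s\<^sub>n\<^sup>B(f) x\<^sub>n\<close> (\<open>deriv_mult_commutator\<close>).  Their left-hand factors are
central and can be cancelled.  The second formula shows that an element \<open>f\<close> of the kernel of
\<open>\<partial>\<^sub>n\<^sup>B\<close> is even in \<open>x\<^sub>n\<close>; by the first one, an element of the kernel of \<open>\<partial>\<^sub>i\<close> that is even in
\<open>x\<^sub>i\<^sub>+\<^sub>1\<close> is even in \<open>x\<^sub>i\<close> (\<open>kernel_s_even\<close>).  So the elements of the common kernel are polynomials
in the squares \<open>x\<^sub>j\<^sup>2\<close>.  These are central, and for such an \<open>f\<close> the right-hand side of the first
formula vanishes exactly when \<open>f\<close> is invariant under exchanging \<open>x\<^sub>i\<^sup>2\<close> and \<open>x\<^sub>i\<^sub>+\<^sub>1\<^sup>2\<close> (\<open>skew_kernel\<close>).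

The rest is the fundamental theorem on symmetric polynomials over the integers, proved with
lexicographically leading monomials (\<open>elem_hom_eq_0\<close>, \<open>symmetric_imp_elem_hom\<close>).  It shows that
invariance under adjacent transpositions, polynomiality in the elementary symmetric functions of the
squares and invariance under all permutations are the same condition.
\<close>

section \<open>Linear maps on formal integer combinations\<close>

definition lin :: "('a \<Rightarrow> 'b::ring_1) \<Rightarrow> ('a \<Rightarrow>\<^sub>0 int) \<Rightarrow> 'b" where
  "lin f p = (\<Sum>k\<in>Poly_Mapping.keys p. of_int (Poly_Mapping.lookup p k) * f k)"

lemma lin_zero [simp]: "lin f 0 = 0"
  by (simp add: lin_def)

lemma lin_single [simp]: "lin f (Poly_Mapping.single k c) = of_int c * f k"
  by (simp add: lin_def)

lemma lin_one [simp]: "lin f 1 = f 0"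
  by (simp add: lin_def lookup_one)

lemma lin_add: "lin f (p + q) = lin f p + lin f q"
  unfolding lin_def by (rule setsum_keys_plus_distrib) (simp_all add: distrib_right)

lemma lin_minus: "lin f (- p) = - lin f p"
  using lin_add[of f p "- p"] by (simp add: eq_neg_iff_add_eq_0 add.commute)

lemma lin_diff: "lin f (p - q) = lin f p - lin f q"
  using lin_add[of f p "- q"] by (simp add: lin_minus)

lemma lin_mult:
  fixes p q :: "'a::monoid_add \<Rightarrow>\<^sub>0 int"
  assumes "\<And>a b. a \<in> Poly_Mapping.keys p \<Longrightarrow> b \<in> Poly_Mapping.keys q \<Longrightarrow> f (a + b) = f a * f b"
  shows "lin f (p * q) = lin f p * lin f q"
proof -
  have 1: "lin f (frag_of a * q) = f a * lin f q" if "a \<in> Poly_Mapping.keys p" for a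
    using order_refl[of "Poly_Mapping.keys q"]
  proof (induction rule: frag_induction)
    case (one b)
    then show ?case using assms that by (simp add: mult_single)
  qed (simp_all add: lin_diff algebra_simps)
  show ?thesis
    using order_refl[of "Poly_Mapping.keys p"]
    by (induction rule: frag_induction) (simp_all add: 1 lin_diff algebra_simps)
qed

section \<open>Anticommuting polynomials on a basis of monomials\<close>

text \<open>Monomials are written with increasing indices, \<open>x\<^sup>a = x\<^sub>1\<^sup>a\<^sup>1 x\<^sub>2\<^sup>a\<^sup>2 \<dots>\<close>.  To bring the
product \<open>x\<^sup>a x\<^sup>b\<close> into this form, every factor of \<open>x\<^sup>b\<close> has to pass those factors of \<open>x\<^sup>a\<close> that
have a larger index, and each passage costs a sign.  The number of passages is biadditive in
\<open>a\<close> and \<open>b\<close>.\<close>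

definition count_below :: "nat \<Rightarrow> (nat \<Rightarrow>\<^sub>0 nat) \<Rightarrow> nat" where
  "count_below i b = (\<Sum>j\<in>Poly_Mapping.keys b. if j < i then Poly_Mapping.lookup b j else 0)"

definition inversions :: "(nat \<Rightarrow>\<^sub>0 nat) \<Rightarrow> (nat \<Rightarrow>\<^sub>0 nat) \<Rightarrow> nat" where
  "inversions a b = (\<Sum>i\<in>Poly_Mapping.keys a. Poly_Mapping.lookup a i * count_below i b)"

lemma count_below_add: "count_below i (b + c) = count_below i b + count_below i c"
  unfolding count_below_def by (rule setsum_keys_plus_distrib) auto

lemma inversions_add_left: "inversions (a + b) c = inversions a c + inversions b c"
  unfolding inversions_def by (rule setsum_keys_plus_distrib) (auto simp: algebra_simps)

lemma inversions_add_right: "inversions a (b + c) = inversions a b + inversions a c"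
  unfolding inversions_def by (simp add: count_below_add algebra_simps sum.distrib)

lemma inversions_zero [simp]: "inversions 0 b = 0" "inversions a 0 = 0"
  by (simp_all add: inversions_def count_below_def)

definition swap_sign :: "(nat \<Rightarrow>\<^sub>0 nat) \<Rightarrow> (nat \<Rightarrow>\<^sub>0 nat) \<Rightarrow> int" where
  "swap_sign a b = (- 1) ^ inversions a b"

lemma swap_sign_zero [simp]: "swap_sign 0 b = 1" "swap_sign a 0 = 1"
  by (simp_all add: swap_sign_def)

lemma swap_sign_add_left: "swap_sign (a + b) c = swap_sign a c * swap_sign b c"
  by (simp add: swap_sign_def inversions_add_left power_add)

lemma swap_sign_add_right: "swap_sign a (b + c) = swap_sign a b * swap_sign a c"
  by (simp add: swap_sign_def inversions_add_right power_add)

lemma abs_swap_sign [simp]: "\<bar>swap_sign a b\<bar> = 1"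
  by (simp add: swap_sign_def power_abs)

lemma swap_sign_square [simp]: "swap_sign a b * swap_sign a b = 1"
  by (simp add: swap_sign_def flip: power_mult_distrib)

type_synonym mpoly = "(nat \<Rightarrow>\<^sub>0 nat) \<Rightarrow>\<^sub>0 int"

definition skew_times :: "mpoly \<Rightarrow> mpoly \<Rightarrow> mpoly" where
  "skew_times p q =
     frag_extend (\<lambda>a. frag_extend (\<lambda>b. frag_cmul (swap_sign a b) (frag_of (a + b))) q) p"

lemma frag_extend_add_fun:
  "frag_extend (\<lambda>a. f a + g a) p = frag_extend f p + frag_extend g p"
  by (simp add: frag_extend_def frag_cmul_distrib2 sum.distrib)

lemma skew_times_add_left: "skew_times (p + q) r = skew_times p r + skew_times q r"
  by (simp add: skew_times_def frag_extend_add)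

lemma skew_times_add_right: "skew_times p (q + r) = skew_times p q + skew_times p r"
  by (simp add: skew_times_def frag_extend_add frag_extend_add_fun)

lemma skew_times_zero [simp]: "skew_times 0 q = 0" "skew_times p 0 = 0"
  by (simp_all add: skew_times_def frag_extend_eq_0)

lemma skew_times_cmul_left: "skew_times (frag_cmul c p) r = frag_cmul c (skew_times p r)"
  by (simp add: skew_times_def frag_extend_cmul)

lemma skew_times_cmul_right: "skew_times p (frag_cmul c r) = frag_cmul c (skew_times p r)"
  by (simp add: skew_times_def frag_extend_def frag_cmul_sum frag_extend_cmul mult.commute
      flip: frag_extend_def) (simp add: frag_extend_def frag_cmul_sum  mult.commute mult.left_commute)

lemma skew_times_minus: "skew_times (- p) q = - skew_times p q" "skew_times p (- q) = - skew_times p q"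
  using skew_times_cmul_left[of "-1" p q] skew_times_cmul_right[of p "-1" q] by simp_all

lemma skew_times_diff: "skew_times (p - q) r = skew_times p r - skew_times q r"
   "skew_times r (p - q) = skew_times r p - skew_times r q"
  using skew_times_add_left[of p "-q" r] skew_times_add_right[of r p "-q"] by (simp_all add: skew_times_minus)

lemma skew_times_frag_of:
  "skew_times (frag_of a) (frag_of b) = frag_cmul (swap_sign a b) (frag_of (a + b))"
  by (simp add: skew_times_def)

text \<open>Since the sign is multiplicative in each argument, both ways of bracketing
\<open>x\<^sup>a x\<^sup>b x\<^sup>c\<close> produce the signs of the three pairs \<open>(a, b)\<close>, \<open>(a, c)\<close> and \<open>(b, c)\<close>.\<close>

lemma skew_times_assoc: "skew_times (skew_times p q) r = skew_times p (skew_times q r)"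
proof -
  have 1: "skew_times (skew_times (frag_of a) (frag_of b)) (frag_of c) =
    skew_times (frag_of a) (skew_times (frag_of b) (frag_of c))" for a b c
    by (simp add: skew_times_frag_of skew_times_cmul_left skew_times_cmul_right swap_sign_add_left
        swap_sign_add_right add.assoc mult.commute mult.left_commute)
  have 2: "skew_times (skew_times (frag_of a) (frag_of b)) r =
    skew_times (frag_of a) (skew_times (frag_of b) r)" for a b
    using subset_UNIV[of "Poly_Mapping.keys r"]
    by (induction rule: frag_induction) (simp_all add: 1 skew_times_diff)
  have 3: "skew_times (skew_times (frag_of a) q) r = skew_times (frag_of a) (skew_times q r)" for a
    using subset_UNIV[of "Poly_Mapping.keys q"]
    by (induction rule: frag_induction) (simp_all add: 2 skew_times_diff)
  show ?thesis
    using subset_UNIV[of "Poly_Mapping.keys p"]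
    by (induction rule: frag_induction) (simp_all add: 3 skew_times_diff)
qed

lemma skew_times_one [simp]: "skew_times 1 p = p" "skew_times p 1 = p"
proof -
  show "skew_times 1 p = p"
    using subset_UNIV[of "Poly_Mapping.keys p"]
    by (induction rule: frag_induction)
       (simp_all add: skew_times_diff skew_times_frag_of flip: single_one)
  show "skew_times p 1 = p"
    using subset_UNIV[of "Poly_Mapping.keys p"]
    by (induction rule: frag_induction)
       (simp_all add: skew_times_diff skew_times_frag_of flip: single_one)
qed

text \<open>The formal sums of exponents already carry the commutative product of a polynomial ring, which is
used below for the squares of the variables; the twisted product therefore lives on a copy of the
type.  There is one algebra for all numbers of variables.\<close>

typedef skew = "UNIV :: mpoly set" morphisms coeffs Skew by simp

setup_lifting type_definition_skew

instantiation skew :: ring_1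
begin

lift_definition zero_skew :: skew is "0" .
lift_definition one_skew :: skew is "1" .
lift_definition plus_skew :: "skew \<Rightarrow> skew \<Rightarrow> skew" is "(+)" .
lift_definition minus_skew :: "skew \<Rightarrow> skew \<Rightarrow> skew" is "(-)" .
lift_definition uminus_skew :: "skew \<Rightarrow> skew" is "uminus" .
lift_definition times_skew :: "skew \<Rightarrow> skew \<Rightarrow> skew" is skew_times .

instance
  by (standard; transfer)
     (simp_all add: algebra_simps skew_times_assoc skew_times_add_left skew_times_add_right)

end

definition xmonom :: "(nat \<Rightarrow>\<^sub>0 nat) \<Rightarrow> skew" where
  "xmonom a = Skew (frag_of a)"

abbreviation unit_exp :: "nat \<Rightarrow> nat \<Rightarrow>\<^sub>0 nat" where
  "unit_exp i \<equiv> Poly_Mapping.single i 1"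

definition xvar :: "nat \<Rightarrow> skew" where
  "xvar i = xmonom (unit_exp i)"

abbreviation xcoeff :: "skew \<Rightarrow> (nat \<Rightarrow>\<^sub>0 nat) \<Rightarrow> int" where
  "xcoeff f \<equiv> Poly_Mapping.lookup (coeffs f)"

lemma xcoeff_zero [simp]: "xcoeff 0 m = 0"
  by (simp add: zero_skew.rep_eq)

lemma xcoeff_add [simp]: "xcoeff (f + g) m = xcoeff f m + xcoeff g m"
  by (simp add: plus_skew.rep_eq lookup_add)

lemma xcoeff_diff [simp]: "xcoeff (f - g) m = xcoeff f m - xcoeff g m"
  by (simp add: minus_skew.rep_eq lookup_minus)

lemma xcoeff_minus [simp]: "xcoeff (- f) m = - xcoeff f m"
  by (simp add: uminus_skew.rep_eq)

lemma xcoeff_xmonom: "xcoeff (xmonom a) m = (if a = m then 1 else 0)"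
  by (simp add: xmonom_def Skew_inverse)

lemma xmonom_zero [simp]: "xmonom 0 = 1"
  by (simp add: xmonom_def one_skew_def)

lemma xmonom_mult: "xmonom a * xmonom b = of_int (swap_sign a b) * xmonom (a + b)"
proof -
  have "xmonom a * xmonom b = Skew (frag_cmul (swap_sign a b) (frag_of (a + b)))"
    by (simp add: xmonom_def times_skew.abs_eq skew_times_frag_of)
  also have "\<dots> = of_int (swap_sign a b) * xmonom (a + b)"
    by (cases "even (inversions a b)") (simp_all add: swap_sign_def xmonom_def uminus_skew.abs_eq)
  finally show ?thesis .
qed

lemma skew_induct [consumes 1, case_names zero xmonom diff]:
  assumes "Poly_Mapping.keys (coeffs f) \<subseteq> S"
    and "P 0" and "\<And>a. a \<in> S \<Longrightarrow> P (xmonom a)" and "\<And>f g. P f \<Longrightarrow> P g \<Longrightarrow> P (f - g)"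
  shows "P f"
proof -
  have "P (Skew p)" if "Poly_Mapping.keys p \<subseteq> S" for p
    using that
  proof (induction rule: frag_induction)
    case zero then show ?case using assms(2) by (simp add: zero_skew_def)
  next
    case (one a) then show ?case using assms(3) by (simp add: xmonom_def)
  next
    case (diff p q) then show ?case using assms(4)[of "Skew p" "Skew q"] by (simp add: minus_skew.abs_eq)
  qed
  from this[of "coeffs f"] assms(1) show ?thesis by (simp add: coeffs_inverse)
qed

lemma skew_induct_UNIV [case_names zero xmonom diff]:
  assumes "P 0" and "\<And>a. P (xmonom a)" and "\<And>f g. P f \<Longrightarrow> P g \<Longrightarrow> P (f - g)"
  shows "P f"
  using subset_UNIV by (rule skew_induct) (use assms in auto)

lemma xcoeff_of_int_times [simp]: "xcoeff (of_int c * f) m = c * xcoeff f m"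
proof (induction c rule: int_induct[of _ 0])
  case (step1 i) then show ?case by (simp add: algebra_simps)
next
  case (step2 i) then show ?case by (simp add: algebra_simps)
qed simp

lemma xcoeff_xmonom_times: "xcoeff (xmonom a * f) (a + b) = swap_sign a b * xcoeff f b"
  by (induction f rule: skew_induct_UNIV)
     (auto simp: right_diff_distrib xmonom_mult xcoeff_xmonom)

lemma xcoeff_times_xmonom: "xcoeff (f * xmonom a) (b + a) = swap_sign b a * xcoeff f b"
  by (induction f rule: skew_induct_UNIV)
     (auto simp: right_diff_distrib left_diff_distrib xmonom_mult xcoeff_xmonom)

lemma xcoeff_xmonom_times_eq_0:
  assumes "\<And>b. m \<noteq> a + b"
  shows "xcoeff (xmonom a * f) m = 0" "xcoeff (f * xmonom a) m = 0"
proof -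
  show "xcoeff (xmonom a * f) m = 0"
    by (induction f rule: skew_induct_UNIV)
       (use assms in \<open>auto simp: algebra_simps xmonom_mult xcoeff_xmonom\<close>)
  have "m \<noteq> b + a" for b using assms[of b] by (simp add: add.commute)
  then show "xcoeff (f * xmonom a) m = 0"
    by (induction f rule: skew_induct_UNIV)
       (auto simp: algebra_simps xmonom_mult xcoeff_xmonom)
qed

lemma inversions_single_single: "inversions (Poly_Mapping.single i c) (Poly_Mapping.single j d) = (if j < i then c * d else 0)"
  by (simp add: inversions_def count_below_def)

lemma xvar_anticommute: "i \<noteq> j \<Longrightarrow> xvar i * xvar j + xvar j * xvar i = 0"
  by (auto simp: xvar_def xmonom_mult swap_sign_def inversions_single_single add.commute not_less)

section \<open>Straightening of words\<close>

definition word_prod :: "(nat \<Rightarrow> skew) \<Rightarrow> nat list \<Rightarrow> skew" where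
  "word_prod v w = prod_list (map v w)"

lemma word_prod_Nil [simp]: "word_prod v [] = 1"
  and word_prod_Cons: "word_prod v (i # w) = v i * word_prod v w"
  and word_prod_add: "word_prod v (w + w') = word_prod v w * word_prod v w'"
  and word_prod_zero [simp]: "word_prod v 0 = 1"
  by (simp_all add: word_prod_def plus_list_def zero_list_def)

lemma lin_word_prod_mult: "lin (word_prod v) (p * q) = lin (word_prod v) p * lin (word_prod v) q"
  by (rule lin_mult) (rule word_prod_add)

lemma lin_word_prod_gen [simp]: "lin (word_prod v) (free_gen i) = v i"
  by (simp add: free_gen_def word_prod_Cons)

text \<open>The exponent of the monomial to which a word evaluates up to sign.\<close>

definition word_exp :: "nat list \<Rightarrow> (nat \<Rightarrow>\<^sub>0 nat)" where
  "word_exp w = sum_list (map unit_exp w)"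

lemma word_exp_simps [simp]: "word_exp [] = 0" "word_exp (i # w) = unit_exp i + word_exp w"
  by (simp_all add: word_exp_def)

lemma lookup_word_exp: "Poly_Mapping.lookup (word_exp w) i = count (mset w) i"
  by (induction w) (auto simp: lookup_add lookup_single when_def)

lemma keys_word_exp: "Poly_Mapping.keys (word_exp w) = set w"
  by (auto simp: in_keys_iff lookup_word_exp)

lemma word_exp_sort [simp]: "word_exp (sort w) = word_exp w"
  by (rule poly_mapping_eqI) (simp add: lookup_word_exp)

lemma word_exp_eq_iff: "word_exp w = word_exp w' \<longleftrightarrow> mset w = mset w'"
  by (auto simp: poly_mapping_eq_iff fun_eq_iff lookup_word_exp multiset_eq_iff)

lemma word_prod_sorted: "sorted w \<Longrightarrow> word_prod xvar w = xmonom (word_exp w)"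
proof (induction w)
  case (Cons i w)
  then have "count_below i (word_exp w) = 0"
    by (auto simp: count_below_def keys_word_exp)
  then have "swap_sign (unit_exp i) (word_exp w) = 1"
    by (simp add: swap_sign_def inversions_def)
  with Cons show ?case by (simp add: word_prod_Cons xvar_def xmonom_mult)
qed simp

lemma word_exp_surj: "\<exists>w. sorted w \<and> word_exp w = a"
proof -
  have "\<exists>w. word_exp w = a"
  proof -
    define M where "M = Abs_multiset (Poly_Mapping.lookup a)"
    have "count M = Poly_Mapping.lookup a"
      unfolding M_def by (rule count_Abs_multiset) simp
    moreover obtain w where "mset w = M" using ex_mset by blast
    ultimately show ?thesis by (metis lookup_word_exp poly_mapping_eqI)
  qed
  then show ?thesis by (metis sorted_sort word_exp_sort)
qed

definition exps_in :: "nat \<Rightarrow> (nat \<Rightarrow>\<^sub>0 nat) set" where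
  "exps_in n = {m. Poly_Mapping.keys m \<subseteq> {1..n}}"

definition skew_pol :: "nat \<Rightarrow> skew set" where
  "skew_pol n = {f. Poly_Mapping.keys (coeffs f) \<subseteq> exps_in n}"

lemma exps_in_zero [simp]: "0 \<in> exps_in n"
  by (simp add: exps_in_def)

lemma exps_in_add: "a \<in> exps_in n \<Longrightarrow> b \<in> exps_in n \<Longrightarrow> a + b \<in> exps_in n"
  using Poly_Mapping.keys_add[of a b] by (auto simp: exps_in_def)

lemma exps_in_single: "i \<in> {1..n} \<Longrightarrow> Poly_Mapping.single i c \<in> exps_in n"
  by (simp add: exps_in_def)

lemma exps_in_word_exp: "word_exp w \<in> exps_in n \<longleftrightarrow> w \<in> lists {1..n}"
  by (auto simp: exps_in_def keys_word_exp)

lemma skew_pol_iff: "f \<in> skew_pol n \<longleftrightarrow> (\<forall>m. m \<notin> exps_in n \<longrightarrow> xcoeff f m = 0)"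
  by (auto simp: skew_pol_def in_keys_iff)

lemma skew_pol_zero [simp]: "0 \<in> skew_pol n"
  and skew_pol_diff: "f \<in> skew_pol n \<Longrightarrow> g \<in> skew_pol n \<Longrightarrow> f - g \<in> skew_pol n"
  and skew_pol_add: "f \<in> skew_pol n \<Longrightarrow> g \<in> skew_pol n \<Longrightarrow> f + g \<in> skew_pol n"
  and skew_pol_minus: "f \<in> skew_pol n \<Longrightarrow> - f \<in> skew_pol n"
  and skew_pol_of_int_mult: "f \<in> skew_pol n \<Longrightarrow> of_int c * f \<in> skew_pol n"
  and skew_pol_xmonom: "a \<in> exps_in n \<Longrightarrow> xmonom a \<in> skew_pol n"
  by (auto simp: skew_pol_iff xcoeff_xmonom)

lemma skew_pol_one [simp]: "1 \<in> skew_pol n"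
  using skew_pol_xmonom[of 0 n] by simp

lemma skew_pol_xvar: "i \<in> {1..n} \<Longrightarrow> xvar i \<in> skew_pol n"
  unfolding xvar_def by (intro skew_pol_xmonom exps_in_single)

lemma skew_pol_induct [consumes 1, case_names zero xmonom diff]:
  assumes "f \<in> skew_pol n"
    and "P 0" and "\<And>a. a \<in> exps_in n \<Longrightarrow> P (xmonom a)" and "\<And>f g. P f \<Longrightarrow> P g \<Longrightarrow> P (f - g)"
  shows "P f"
  using assms unfolding skew_pol_def by (auto intro: skew_induct)

lemma skew_pol_mult:
  assumes "f \<in> skew_pol n" "g \<in> skew_pol n"
  shows "f * g \<in> skew_pol n"
  using assms(1)
proof (induction rule: skew_pol_induct)
  case (xmonom a)
  show ?case using assms(2)
  proof (induction rule: skew_pol_induct)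
    case (xmonom b)
    with \<open>a \<in> exps_in n\<close> show ?case
      by (simp add: xmonom_mult exps_in_add skew_pol_xmonom skew_pol_of_int_mult)
  qed (simp_all add: right_diff_distrib skew_pol_diff)
qed (simp_all add: left_diff_distrib skew_pol_diff)

definition skew_ring :: "nat \<Rightarrow> skew ring" where
  "skew_ring n = \<lparr>carrier = skew_pol n, monoid.mult = (*), one = 1, ring.zero = 0, ring.add = (+)\<rparr>"

lemma skew_ring_simps [simp]:
  "carrier (skew_ring n) = skew_pol n" "f \<otimes>\<^bsub>skew_ring n\<^esub> g = f * g" "\<one>\<^bsub>skew_ring n\<^esub> = 1"
  "\<zero>\<^bsub>skew_ring n\<^esub> = 0" "f \<oplus>\<^bsub>skew_ring n\<^esub> g = f + g"
  by (simp_all add: skew_ring_def)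

lemma ring_skew_ring: "ring (skew_ring n)"
proof (rule ringI)
  show "abelian_group (skew_ring n)"
  proof (rule abelian_groupI)
    fix x assume "x \<in> carrier (skew_ring n)"
    then show "\<exists>y\<in>carrier (skew_ring n). y \<oplus>\<^bsub>skew_ring n\<^esub> x = \<zero>\<^bsub>skew_ring n\<^esub>"
      by (intro bexI[of _ "- x"]) (auto simp: skew_pol_minus)
  qed (auto simp: ac_simps skew_pol_add)
  show "monoid (skew_ring n)"
    by (rule monoidI) (auto simp: mult.assoc skew_pol_mult)
qed (auto simp: algebra_simps)

lemma free_alg_simps:
  "p \<in> carrier (free_alg n) \<longleftrightarrow> Poly_Mapping.keys p \<subseteq> lists {1..n}"
  "p \<otimes>\<^bsub>free_alg n\<^esub> q = p * q" "\<one>\<^bsub>free_alg n\<^esub> = 1" "\<zero>\<^bsub>free_alg n\<^esub> = 0" "p \<oplus>\<^bsub>free_alg n\<^esub> q = p + q"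
  by (simp_all add: free_alg_def)

lemma free_alg_minus:
  assumes "p \<in> carrier (free_alg n)"
  shows "\<ominus>\<^bsub>free_alg n\<^esub> p = - p" and "- p \<in> carrier (free_alg n)"
proof -
  interpret ring "free_alg n" by (rule ring_free_alg)
  show "- p \<in> carrier (free_alg n)" using assms by (simp add: free_alg_simps)
  then show "\<ominus>\<^bsub>free_alg n\<^esub> p = - p" using assms
    by (intro minus_equality) (simp_all add: free_alg_simps)
qed

lemma odd_ideal_closed:
  shows "p \<in> odd_ideal n \<Longrightarrow> p \<in> carrier (free_alg n)"
    and "0 \<in> odd_ideal n"
    and "p \<in> odd_ideal n \<Longrightarrow> q \<in> odd_ideal n \<Longrightarrow> p + q \<in> odd_ideal n"
    and "p \<in> odd_ideal n \<Longrightarrow> - p \<in> odd_ideal n"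
    and "p \<in> odd_ideal n \<Longrightarrow> r \<in> carrier (free_alg n) \<Longrightarrow> r * p \<in> odd_ideal n"
    and "p \<in> odd_ideal n \<Longrightarrow> r \<in> carrier (free_alg n) \<Longrightarrow> p * r \<in> odd_ideal n"
proof -
  interpret ideal "odd_ideal n" "free_alg n" by (rule ideal_odd_ideal)
  show *: "p \<in> odd_ideal n \<Longrightarrow> p \<in> carrier (free_alg n)" by (rule a_Hcarr)
  show "0 \<in> odd_ideal n"
    using additive_subgroup.zero_closed[OF additive_subgroup_axioms] by (simp add: free_alg_simps)
  show "p \<in> odd_ideal n \<Longrightarrow> q \<in> odd_ideal n \<Longrightarrow> p + q \<in> odd_ideal n"
    using additive_subgroup.a_closed[OF additive_subgroup_axioms, of p q] by (simp add: free_alg_simps)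
  show "p \<in> odd_ideal n \<Longrightarrow> - p \<in> odd_ideal n"
    using additive_subgroup.a_inv_closed[OF additive_subgroup_axioms, of p] by (simp add: free_alg_minus *)
  show "p \<in> odd_ideal n \<Longrightarrow> r \<in> carrier (free_alg n) \<Longrightarrow> r * p \<in> odd_ideal n"
    using I_l_closed[of p r] by (simp add: free_alg_simps(2))
  show "p \<in> odd_ideal n \<Longrightarrow> r \<in> carrier (free_alg n) \<Longrightarrow> p * r \<in> odd_ideal n"
    using I_r_closed[of p r] by (simp add: free_alg_simps(2))
qed

lemma odd_ideal_diff: "p \<in> odd_ideal n \<Longrightarrow> q \<in> odd_ideal n \<Longrightarrow> p - q \<in> odd_ideal n"
  using odd_ideal_closed(3)[of p n "- q"] odd_ideal_closed(4)[of q n] by simp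

lemma odd_rels_closed: "odd_rels n \<subseteq> carrier (free_alg n)"
proof
  fix p assume "p \<in> odd_rels n"
  then obtain i j where "i \<in> {1..n}" "j \<in> {1..n}" "p = free_gen i * free_gen j + free_gen j * free_gen i"
    by (auto simp: odd_rels_def)
  then show "p \<in> carrier (free_alg n)"
    using keys_add[of "frag_of [i, j]" "frag_of [j, i]"]
    by (auto simp: free_alg_simps free_gen_def mult_single plus_list_def)
qed

lemma odd_rels_subset_odd_ideal: "odd_rels n \<subseteq> odd_ideal n"
  unfolding odd_ideal_def using odd_rels_closed by (rule ring.genideal_self[OF ring_free_alg])

text \<open>Minimality of the generated ideal, in the form in which it shows that a map vanishes on the ideal.\<close>

lemma odd_ideal_induct [consumes 1, case_names rel zero add minus mult_left mult_right]:
  assumes p: "p \<in> odd_ideal n"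
    and rel: "\<And>i j. i \<in> {1..n} \<Longrightarrow> j \<in> {1..n} \<Longrightarrow> i \<noteq> j \<Longrightarrow> P (free_gen i * free_gen j + free_gen j * free_gen i)"
    and zero: "P 0" and add: "\<And>p q. P p \<Longrightarrow> P q \<Longrightarrow> P (p + q)" and minus: "\<And>p. P p \<Longrightarrow> P (- p)"
    and mult_left: "\<And>p r. r \<in> carrier (free_alg n) \<Longrightarrow> P p \<Longrightarrow> P (r * p)"
    and mult_right: "\<And>p r. r \<in> carrier (free_alg n) \<Longrightarrow> P p \<Longrightarrow> P (p * r)"
  shows "P p"
proof -
  interpret ring "free_alg n" by (rule ring_free_alg)
  let ?J = "{p \<in> carrier (free_alg n). P p}"
  have "ideal ?J (free_alg n)"
  proof (rule idealI)
    show "subgroup ?J (add_monoid (free_alg n))"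
    proof
      fix x assume "x \<in> ?J"
      then show "inv\<^bsub>add_monoid (free_alg n)\<^esub> x \<in> ?J"
        using free_alg_minus[of x n] minus[of x] by (simp add: a_inv_def)
    next
      fix x y assume "x \<in> ?J" "y \<in> ?J"
      then show "x \<otimes>\<^bsub>add_monoid (free_alg n)\<^esub> y \<in> ?J"
        using a_closed[of x y] add by (simp add: free_alg_simps(5))
    qed (use assms(3) in \<open>auto simp: free_alg_simps\<close>)
  next
    fix a x assume "a \<in> ?J" "x \<in> carrier (free_alg n)"
    then show "x \<otimes>\<^bsub>free_alg n\<^esub> a \<in> ?J" "a \<otimes>\<^bsub>free_alg n\<^esub> x \<in> ?J"
      using m_closed[of a x] m_closed[of x a] mult_left mult_right by (simp_all add: free_alg_simps(2))
  qed (rule ring_axioms)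
  moreover have "odd_rels n \<subseteq> ?J"
  proof
    fix p assume p: "p \<in> odd_rels n"
    then have "P p" using rel by (auto simp: odd_rels_def)
    with p show "p \<in> ?J" using odd_rels_closed by blast
  qed
  ultimately have "odd_ideal n \<subseteq> ?J"
    unfolding odd_ideal_def by (rule genideal_minimal)
  with p show ?thesis by blast
qed

lemma frag_of_word_closed: "w \<in> lists {1..n} \<Longrightarrow> frag_of w \<in> carrier (free_alg n)"
  by (simp add: free_alg_simps)

text \<open>Moving a letter into its place in a sorted word exchanges it with smaller letters, one at a time,
and each exchange is an instance of a relation.  The resulting sign is left open here: evaluation
vanishes on the ideal and so determines it afterwards.\<close>

lemma insort_mod_odd_ideal:
  assumes "i \<in> {1..n}" "w \<in> lists {1..n}"
  shows "frag_of (i # w) - frag_of (insort i w) \<in> odd_ideal n \<or>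
         frag_of (i # w) + frag_of (insort i w) \<in> odd_ideal n"
  using assms(2)
proof (induction w)
  case (Cons j w)
  show ?case
  proof (cases "i \<le> j")
    case True
    then show ?thesis by (simp add: odd_ideal_closed(2))
  next
    case False
    have "free_gen i * free_gen j + free_gen j * free_gen i \<in> odd_rels n"
      unfolding odd_rels_def by (rule CollectI, rule exI[of _ i], rule exI[of _ j])
        (use Cons.hyps(1) assms(1) False in auto)
    then have "(free_gen i * free_gen j + free_gen j * free_gen i) * frag_of w \<in> odd_ideal n"
      using Cons.hyps(2) odd_rels_subset_odd_ideal[of n]
      by (intro odd_ideal_closed(6) frag_of_word_closed) auto
    then have 1: "frag_of (i # j # w) + frag_of (j # i # w) \<in> odd_ideal n"
      by (simp add: free_gen_def distrib_right mult_single plus_list_def)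
    have *: "frag_of (j # u) = free_gen j * frag_of u" for u
      by (simp add: free_gen_def mult_single plus_list_def)
    have j: "free_gen j \<in> carrier (free_alg n)"
      using Cons.hyps by (intro free_gen_closed) auto
    from Cons.IH show ?thesis
    proof
      assume "frag_of (i # w) - frag_of (insort i w) \<in> odd_ideal n"
      from odd_ideal_closed(5)[OF this j]
      have "frag_of (j # i # w) - frag_of (j # insort i w) \<in> odd_ideal n"
        unfolding * by (simp add: algebra_simps)
      from odd_ideal_diff[OF 1 this] False show ?thesis by (simp add: algebra_simps)
    next
      assume "frag_of (i # w) + frag_of (insort i w) \<in> odd_ideal n"
      from odd_ideal_closed(5)[OF this j]
      have "frag_of (j # i # w) + frag_of (j # insort i w) \<in> odd_ideal n"
        unfolding * by (simp add: algebra_simps)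
      from odd_ideal_diff[OF 1 this] False show ?thesis by (simp add: algebra_simps)
    qed
  qed
qed (simp add: odd_ideal_closed(2))

lemma sort_mod_odd_ideal:
  assumes "w \<in> lists {1..n}"
  shows "frag_of w - frag_of (sort w) \<in> odd_ideal n \<or> frag_of w + frag_of (sort w) \<in> odd_ideal n"
  using assms
proof (induction w)
  case (Cons i w)
  have *: "frag_of (i # u) = free_gen i * frag_of u" for u
    by (simp add: free_gen_def mult_single plus_list_def)
  have i: "free_gen i \<in> carrier (free_alg n)"
    using Cons.hyps by (intro free_gen_closed) auto
  have "sort w \<in> lists {1..n}" using Cons.hyps(2) by auto
  from insort_mod_odd_ideal[OF _ this] Cons.hyps(1)
  have 1: "frag_of (i # sort w) - frag_of (insort i (sort w)) \<in> odd_ideal n \<or>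
         frag_of (i # sort w) + frag_of (insort i (sort w)) \<in> odd_ideal n" by blast
  have "free_gen i * (frag_of w - frag_of (sort w)) \<in> odd_ideal n \<or>
        free_gen i * (frag_of w + frag_of (sort w)) \<in> odd_ideal n"
    using Cons.IH odd_ideal_closed(5)[OF _ i] by blast
  then have 2: "frag_of (i # w) - frag_of (i # sort w) \<in> odd_ideal n \<or>
         frag_of (i # w) + frag_of (i # sort w) \<in> odd_ideal n"
    by (simp add: * algebra_simps)
  let ?a = "frag_of (i # w)" and ?b = "frag_of (i # sort w)" and ?c = "frag_of (insort i (sort w))"
  from 1 2 have "?a - ?c \<in> odd_ideal n \<or> ?a + ?c \<in> odd_ideal n"
  proof (elim disjE)
    assume "?b - ?c \<in> odd_ideal n" "?a - ?b \<in> odd_ideal n"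
    from odd_ideal_closed(3)[OF this] show ?thesis by (simp add: algebra_simps)
  next
    assume "?b - ?c \<in> odd_ideal n" "?a + ?b \<in> odd_ideal n"
    from odd_ideal_diff[OF this(2,1)] show ?thesis by (simp add: algebra_simps)
  next
    assume "?b + ?c \<in> odd_ideal n" "?a - ?b \<in> odd_ideal n"
    from odd_ideal_closed(3)[OF this] show ?thesis by (simp add: algebra_simps)
  next
    assume "?b + ?c \<in> odd_ideal n" "?a + ?b \<in> odd_ideal n"
    from odd_ideal_diff[OF this(2,1)] show ?thesis by (simp add: algebra_simps)
  qed
  then show ?case by simp
qed (simp add: odd_ideal_closed(2))

abbreviation skew_eval :: "(nat list \<Rightarrow>\<^sub>0 int) \<Rightarrow> skew" where
  "skew_eval \<equiv> lin (word_prod xvar)"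

lemma lin_word_prod_odd_ideal:
  assumes "p \<in> odd_ideal n"
    and "\<And>i j. i \<in> {1..n} \<Longrightarrow> j \<in> {1..n} \<Longrightarrow> i \<noteq> j \<Longrightarrow> v i * v j + v j * v i = 0"
  shows "lin (word_prod v) p = 0"
  using assms(1)
  by (induction rule: odd_ideal_induct)
     (use assms(2) in \<open>auto simp: lin_add lin_minus lin_word_prod_mult\<close>)

lemma skew_eval_odd_ideal: "p \<in> odd_ideal n \<Longrightarrow> skew_eval p = 0"
  by (erule lin_word_prod_odd_ideal) (rule xvar_anticommute)

text \<open>The increasing word is a preferred preimage of a monomial under evaluation.  Extended linearly, it
gives a section of the evaluation map on words.\<close>

definition sorted_word :: "(nat \<Rightarrow>\<^sub>0 nat) \<Rightarrow> nat list" where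
  "sorted_word a = (SOME w. sorted w \<and> word_exp w = a)"

lemma sorted_word: "sorted (sorted_word a)" "word_exp (sorted_word a) = a"
  using someI_ex[OF word_exp_surj[of a]] by (simp_all add: sorted_word_def)

lemma sorted_word_word_exp: "sorted_word (word_exp w) = sort w"
proof -
  have "mset (sorted_word (word_exp w)) = mset w"
    using sorted_word(2)[of "word_exp w"] by (simp only: word_exp_eq_iff)
  then show ?thesis
    using sorted_word(1) by (intro properties_for_sort[symmetric]) simp_all
qed

definition normal_form :: "skew \<Rightarrow> (nat list \<Rightarrow>\<^sub>0 int)" where
  "normal_form f = frag_extend (\<lambda>a. frag_of (sorted_word a)) (coeffs f)"

lemma normal_form_diff: "normal_form (f - g) = normal_form f - normal_form g"
  by (simp add: normal_form_def minus_skew.rep_eq frag_extend_diff)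

lemma normal_form_zero [simp]: "normal_form 0 = 0"
  by (simp add: normal_form_def zero_skew.rep_eq)

lemma normal_form_xmonom: "normal_form (xmonom a) = frag_of (sorted_word a)"
  by (simp add: normal_form_def xmonom_def Skew_inverse)

lemma normal_form_minus: "normal_form (- f) = - normal_form f"
  using normal_form_diff[of 0 f] by simp

lemma skew_eval_normal_form: "skew_eval (normal_form f) = f"
  by (induction f rule: skew_induct_UNIV)
     (simp_all add: normal_form_diff lin_diff normal_form_xmonom word_prod_sorted sorted_word)

lemma normal_form_closed: "f \<in> skew_pol n \<Longrightarrow> normal_form f \<in> carrier (free_alg n)"
proof (induction rule: skew_pol_induct)
  case (xmonom a)
  then have "sorted_word a \<in> lists {1..n}"
    by (metis sorted_word(2) exps_in_word_exp)
  then show ?case by (simp add: normal_form_xmonom frag_of_word_closed)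
next
  case (diff f g)
  then show ?case
    using keys_diff[of "normal_form f" "normal_form g"] by (auto simp: normal_form_diff free_alg_simps)
qed (simp add: free_alg_simps)

text \<open>This carries the basis theorem.  A word equals its sorted word up to a sign modulo the relations;
evaluation sees the same sign, so passing to the value and back to the normal form stays within
the coset.  In particular a combination of words with value \<open>0\<close> lies in the ideal.\<close>

lemma mod_odd_ideal_normal_form:
  assumes "p \<in> carrier (free_alg n)"
  shows "p - normal_form (skew_eval p) \<in> odd_ideal n"
proof -
  have "Poly_Mapping.keys p \<subseteq> lists {1..n}" using assms by (simp add: free_alg_simps)
  then show ?thesis
  proof (induction rule: frag_induction)
    case (one w)
    let ?s = "frag_of (sort w)"
    have s: "normal_form (skew_eval ?s) = ?s"
      by (simp add: word_prod_sorted normal_form_xmonom sorted_word_word_exp)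
    from sort_mod_odd_ideal[OF one] show ?case
    proof
      assume *: "frag_of w - ?s \<in> odd_ideal n"
      then have "skew_eval (frag_of w) = skew_eval ?s"
        using skew_eval_odd_ideal[OF *] by (simp add: lin_diff)
      with * s show ?thesis by simp
    next
      assume *: "frag_of w + ?s \<in> odd_ideal n"
      then have "skew_eval (frag_of w) = - skew_eval ?s"
        using skew_eval_odd_ideal[OF *] by (simp only: lin_add eq_neg_iff_add_eq_0)
      with * s show ?thesis by (simp add: normal_form_minus)
    qed
  next
    case (diff p q)
    from odd_ideal_diff[OF diff] show ?case by (simp add: lin_diff normal_form_diff algebra_simps)
  qed (simp add: odd_ideal_closed(2))
qed

lemma skew_eval_eq_0_iff:
  assumes "p \<in> carrier (free_alg n)"
  shows "skew_eval p = 0 \<longleftrightarrow> p \<in> odd_ideal n"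
  using mod_odd_ideal_normal_form[OF assms] skew_eval_odd_ideal by auto

lemma skew_eval_closed:
  assumes "p \<in> carrier (free_alg n)"
  shows "skew_eval p \<in> skew_pol n"
proof -
  have 1: "word_prod xvar w \<in> skew_pol n" if "w \<in> lists {1..n}" for w
    using that by (induction w) (auto simp: word_prod_Cons intro!: skew_pol_mult skew_pol_xvar)
  have "Poly_Mapping.keys p \<subseteq> lists {1..n}" using assms by (simp add: free_alg_simps)
  then show ?thesis
    by (induction rule: frag_induction) (simp_all add: 1 lin_diff skew_pol_diff)
qed

lemma skew_eval_ring_hom: "ring_hom_ring (free_alg n) (skew_ring n) skew_eval"
  by (intro ring_hom_ringI ring_free_alg ring_skew_ring)
     (simp_all add: skew_eval_closed lin_word_prod_mult lin_add free_alg_simps(2-))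

lemma kernel_skew_eval: "a_kernel (free_alg n) (skew_ring n) skew_eval = odd_ideal n"
  using skew_eval_eq_0_iff odd_ideal_closed(1) by (auto simp: a_kernel_def')

lemma skew_eval_surj: "skew_eval ` carrier (free_alg n) = skew_pol n"
proof
  show "skew_pol n \<subseteq> skew_eval ` carrier (free_alg n)"
    by (metis image_eqI normal_form_closed skew_eval_normal_form subsetI)
qed (auto simp: skew_eval_closed)

text \<open>The map induced by evaluation on the quotient: all members of a coset have the same value.\<close>

definition to_skew :: "(nat list \<Rightarrow>\<^sub>0 int) set \<Rightarrow> skew" where
  "to_skew U = the_elem (skew_eval ` U)"

lemma to_skew_iso: "to_skew \<in> ring_iso (odd_pol n) (skew_ring n)"
proof -
  interpret ring_hom_ring "free_alg n" "skew_ring n" skew_eval by (rule skew_eval_ring_hom)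
  have "(\<lambda>U. the_elem (skew_eval ` U)) \<in> ring_iso (free_alg n Quot a_kernel (free_alg n) (skew_ring n) skew_eval) (skew_ring n)"
    by (rule FactRing_iso_set) (simp add: skew_eval_surj)
  moreover have "to_skew = (\<lambda>U. the_elem (skew_eval ` U))"
    by (rule ext) (rule to_skew_def)
  ultimately show ?thesis
    by (simp only: odd_pol_def kernel_skew_eval)
qed

lemma to_skew_odd_var:
  assumes "i \<in> {1..n}"
  shows "to_skew (odd_var n i) = xvar i"
proof -
  interpret ring_hom_ring "free_alg n" "skew_ring n" skew_eval by (rule skew_eval_ring_hom)
  show ?thesis
    using the_elem_simp[OF free_gen_closed[OF assms]]
    by (simp only: to_skew_def odd_var_def kernel_skew_eval lin_word_prod_gen)
qed

section \<open>Substitutions and twisted derivations\<close>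

definition from_skew :: "nat \<Rightarrow> skew \<Rightarrow> (nat list \<Rightarrow>\<^sub>0 int) set" where
  "from_skew n = inv_into (carrier (odd_pol n)) to_skew"

lemma from_skew_iso: "from_skew n \<in> ring_iso (skew_ring n) (odd_pol n)"
  unfolding from_skew_def by (rule ring_iso_set_sym[OF ring_odd_pol to_skew_iso])

lemma to_skew_closed: "f \<in> carrier (odd_pol n) \<Longrightarrow> to_skew f \<in> skew_pol n"
  using ring_iso_memE(1)[OF to_skew_iso] by simp

lemma from_skew_closed: "f \<in> skew_pol n \<Longrightarrow> from_skew n f \<in> carrier (odd_pol n)"
  using ring_iso_memE(1)[OF from_skew_iso[of n]] by simp

lemma to_skew_from_skew: "f \<in> skew_pol n \<Longrightarrow> to_skew (from_skew n f) = f"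
  using ring_iso_memE(5)[OF to_skew_iso[of n]]
  by (auto simp: from_skew_def bij_betw_def intro!: f_inv_into_f)

lemma from_skew_to_skew: "f \<in> carrier (odd_pol n) \<Longrightarrow> from_skew n (to_skew f) = f"
  using ring_iso_memE(5)[OF to_skew_iso[of n]]
  by (auto simp: from_skew_def bij_betw_def intro!: inv_into_f_f)

lemma to_skew_eqD:
  "f \<in> carrier (odd_pol n) \<Longrightarrow> g \<in> carrier (odd_pol n) \<Longrightarrow> to_skew f = to_skew g \<Longrightarrow> f = g"
  by (metis from_skew_to_skew)

lemma to_skew_hom:
  shows "f \<in> carrier (odd_pol n) \<Longrightarrow> g \<in> carrier (odd_pol n) \<Longrightarrow>
      to_skew (f \<otimes>\<^bsub>odd_pol n\<^esub> g) = to_skew f * to_skew g"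
    and "f \<in> carrier (odd_pol n) \<Longrightarrow> g \<in> carrier (odd_pol n) \<Longrightarrow>
      to_skew (f \<oplus>\<^bsub>odd_pol n\<^esub> g) = to_skew f + to_skew g"
    and "to_skew \<one>\<^bsub>odd_pol n\<^esub> = 1" and "to_skew \<zero>\<^bsub>odd_pol n\<^esub> = 0"
  using ring_iso_memE(2-4)[OF to_skew_iso[of n]] ring_hom_zero[of to_skew "odd_pol n" "skew_ring n"]
    ring_odd_pol ring_skew_ring to_skew_iso[of n]
  by (auto simp: ring_iso_def)

lemma from_skew_hom:
  shows "f \<in> skew_pol n \<Longrightarrow> g \<in> skew_pol n \<Longrightarrow>
      from_skew n (f * g) = from_skew n f \<otimes>\<^bsub>odd_pol n\<^esub> from_skew n g"
    and "f \<in> skew_pol n \<Longrightarrow> g \<in> skew_pol n \<Longrightarrow>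
      from_skew n (f + g) = from_skew n f \<oplus>\<^bsub>odd_pol n\<^esub> from_skew n g"
    and "from_skew n 1 = \<one>\<^bsub>odd_pol n\<^esub>" and "from_skew n 0 = \<zero>\<^bsub>odd_pol n\<^esub>"
  using ring_iso_memE(2-4)[OF from_skew_iso[of n]] ring_hom_zero[of "from_skew n" "skew_ring n" "odd_pol n"]
    ring_odd_pol ring_skew_ring from_skew_iso[of n]
  by (auto simp: ring_iso_def)

lemma to_skew_a_inv:
  assumes "f \<in> carrier (odd_pol n)"
  shows "to_skew (\<ominus>\<^bsub>odd_pol n\<^esub> f) = - to_skew f"
proof -
  interpret ring "odd_pol n" by (rule ring_odd_pol)
  have "to_skew (\<ominus>\<^bsub>odd_pol n\<^esub> f) + to_skew f = 0"
    using to_skew_hom(2)[of "\<ominus>\<^bsub>odd_pol n\<^esub> f" n f] assms by (simp add: l_neg to_skew_hom(4))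
  then show ?thesis by (simp add: eq_neg_iff_add_eq_0)
qed

lemma skew_pol_word_induct [consumes 1, case_names zero word diff]:
  assumes "f \<in> skew_pol n"
    and "P 0" and "\<And>w. w \<in> lists {1..n} \<Longrightarrow> P (word_prod xvar w)"
    and "\<And>f g. f \<in> skew_pol n \<Longrightarrow> g \<in> skew_pol n \<Longrightarrow> P f \<Longrightarrow> P g \<Longrightarrow> P (f - g)"
  shows "P f"
proof -
  have "f \<in> skew_pol n \<and> P f"
    using assms(1)
  proof (induction rule: skew_pol_induct)
    case (xmonom a)
    have "sorted_word a \<in> lists {1..n}"
      using xmonom by (metis sorted_word(2) exps_in_word_exp)
    from assms(3)[OF this] xmonom show ?case
      by (simp add: word_prod_sorted sorted_word skew_pol_xmonom)
  qed (use assms in \<open>auto intro: skew_pol_diff\<close>)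
  then show ?thesis ..
qed

lemma word_prod_closed:
  assumes "\<And>i. i \<in> {1..n} \<Longrightarrow> v i \<in> skew_pol n" and "w \<in> lists {1..n}"
  shows "word_prod v w \<in> skew_pol n"
  using assms(2) by induction (auto simp: word_prod_Cons intro!: skew_pol_mult assms(1))

lemma lin_closed:
  assumes "\<And>w. w \<in> lists {1..n} \<Longrightarrow> F w \<in> skew_pol n" and "p \<in> carrier (free_alg n)"
  shows "lin F p \<in> skew_pol n"
proof -
  have "Poly_Mapping.keys p \<subseteq> lists {1..n}" using assms(2) by (simp add: free_alg_simps)
  then show ?thesis
    by (induction rule: frag_induction) (simp_all add: assms(1) lin_diff skew_pol_diff)
qed

definition subst :: "(nat \<Rightarrow> skew) \<Rightarrow> skew \<Rightarrow> skew" where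
  "subst s f = lin (word_prod s) (normal_form f)"

text \<open>The images of the variables have to satisfy the defining relations for a substitution to be
multiplicative.\<close>

definition skew_relation :: "nat \<Rightarrow> (nat \<Rightarrow> skew) \<Rightarrow> bool" where
  "skew_relation n s \<longleftrightarrow> (\<forall>i\<in>{1..n}. s i \<in> skew_pol n) \<and>
     (\<forall>i\<in>{1..n}. \<forall>j\<in>{1..n}. i \<noteq> j \<longrightarrow> s i * s j + s j * s i = 0)"

lemma subst_zero [simp]: "subst s 0 = 0"
  and subst_diff: "subst s (f - g) = subst s f - subst s g"
  by (simp_all add: subst_def normal_form_diff lin_diff)

lemma subst_minus: "subst s (- f) = - subst s f"
  using subst_diff[of s 0 f] by simp

lemma subst_add: "subst s (f + g) = subst s f + subst s g"
  using subst_diff[of s f "- g"] by (simp add: subst_minus)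

text \<open>The straightening of words only uses the relations, so a linear map on words that kills the
  ideal of relations may be evaluated on any representative.\<close>

lemma lin_normal_form_eval:
  assumes "\<And>p. p \<in> odd_ideal n \<Longrightarrow> lin F p = 0" and "p \<in> carrier (free_alg n)"
  shows "lin F (normal_form (skew_eval p)) = lin F p"
  using assms(1)[OF mod_odd_ideal_normal_form[OF assms(2)]] by (simp add: lin_diff)

lemma free_mult_closed:
  "p \<in> carrier (free_alg n) \<Longrightarrow> q \<in> carrier (free_alg n) \<Longrightarrow> p * q \<in> carrier (free_alg n)"
  using monoid.m_closed[OF ring.is_monoid[OF ring_free_alg], of p n q] by (simp add: free_alg_simps(2))

lemma lin_normal_form_mult:
  assumes "\<And>p. p \<in> odd_ideal n \<Longrightarrow> lin F p = 0" and "f \<in> skew_pol n" "g \<in> skew_pol n"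
  shows "lin F (normal_form (f * g)) = lin F (normal_form f * normal_form g)"
  using lin_normal_form_eval[OF assms(1), of n "normal_form f * normal_form g"] assms(2,3)
  by (simp add: free_mult_closed normal_form_closed lin_word_prod_mult skew_eval_normal_form)

lemma skew_relation_kills: "skew_relation n s \<Longrightarrow> p \<in> odd_ideal n \<Longrightarrow> lin (word_prod s) p = 0"
  by (erule lin_word_prod_odd_ideal) (simp add: skew_relation_def)

lemma subst_mult:
  assumes "skew_relation n s" "f \<in> skew_pol n" "g \<in> skew_pol n"
  shows "subst s (f * g) = subst s f * subst s g"
  unfolding subst_def
  using lin_normal_form_mult[of n, OF skew_relation_kills, OF assms(1) _ assms(2,3)]
  by (simp add: lin_word_prod_mult)

lemma subst_word:
  assumes "skew_relation n s" "w \<in> lists {1..n}"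
  shows "subst s (word_prod xvar w) = word_prod s w"
  using lin_normal_form_eval[OF skew_relation_kills[OF assms(1)] frag_of_word_closed[OF assms(2)]]
  by (simp add: subst_def)

lemma subst_one: "skew_relation n s \<Longrightarrow> subst s 1 = 1"
  using subst_word[of n s "[]"] by simp

lemma subst_xvar: "skew_relation n s \<Longrightarrow> i \<in> {1..n} \<Longrightarrow> subst s (xvar i) = s i"
  using subst_word[of n s "[i]"] by (simp add: word_prod_Cons)

lemma subst_closed:
  assumes "skew_relation n s" "f \<in> skew_pol n"
  shows "subst s f \<in> skew_pol n"
  unfolding subst_def
  by (rule lin_closed[OF word_prod_closed normal_form_closed])
     (use assms in \<open>auto simp: skew_relation_def\<close>)

lemma subst_unique:
  assumes s: "skew_relation n s" and f: "f \<in> skew_pol n"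
    and add: "\<And>f g. f \<in> skew_pol n \<Longrightarrow> g \<in> skew_pol n \<Longrightarrow> \<psi> (f + g) = \<psi> f + \<psi> g"
    and mult: "\<And>f g. f \<in> skew_pol n \<Longrightarrow> g \<in> skew_pol n \<Longrightarrow> \<psi> (f * g) = \<psi> f * \<psi> g"
    and one: "\<psi> 1 = 1" and xvar: "\<And>i. i \<in> {1..n} \<Longrightarrow> \<psi> (xvar i) = s i"
  shows "\<psi> f = subst s f"
  using f
proof (induction rule: skew_pol_word_induct)
  case zero
  show ?case using add[of 0 0] by simp
next
  case (word w)
  then have "\<psi> (word_prod xvar w) = word_prod s w"
  proof (induction w)
    case (Cons i w)
    have "word_prod xvar w \<in> skew_pol n"
      using Cons.hyps by (intro word_prod_closed skew_pol_xvar) auto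
    with Cons show ?case
      using mult[of "xvar i" "word_prod xvar w"] xvar[of i]
      by (simp add: word_prod_Cons skew_pol_xvar word_prod_closed)
  qed (simp add: one)
  with word s show ?case by (simp add: subst_word)
next
  case (diff f g)
  then show ?case
    using add[of "f - g" g] by (simp add: subst_diff skew_pol_diff eq_diff_eq)
qed

text \<open>The twisted Leibniz rule, unfolded letter by letter from the left.  On words it defines an operator
for arbitrary values on the generators; the conditions come in only when passing to the quotient.\<close>

fun word_deriv :: "(nat \<Rightarrow> skew) \<Rightarrow> nat set \<Rightarrow> nat list \<Rightarrow> skew" where
  "word_deriv s J [] = 0"
| "word_deriv s J (i # w) = of_bool (i \<in> J) * word_prod xvar w + s i * word_deriv s J w"

lemma word_deriv_add:
  "word_deriv s J (u + w) = word_deriv s J u * word_prod xvar w + word_prod s u * word_deriv s J w"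
proof (induction u)
  case (Cons i u)
  then have "word_deriv s J (u @ w) = word_deriv s J u * word_prod xvar w + word_prod s u * word_deriv s J w"
    by (simp add: plus_list_def)
  moreover have "word_prod xvar (u @ w) = word_prod xvar u * word_prod xvar w"
    using word_prod_add[of xvar u w] by (simp add: plus_list_def)
  ultimately show ?case by (simp add: word_prod_Cons algebra_simps plus_list_def)
qed (simp add: plus_list_def)

lemma lin_word_deriv_mult:
  "lin (word_deriv s J) (p * q) =
    lin (word_deriv s J) p * skew_eval q + lin (word_prod s) p * lin (word_deriv s J) q"
proof -
  have 1: "lin (word_deriv s J) (frag_of u * q) =
    word_deriv s J u * skew_eval q + word_prod s u * lin (word_deriv s J) q" for u
    using subset_UNIV[of "Poly_Mapping.keys q"]
    by (induction rule: frag_induction)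
       (simp_all add: lin_diff mult_single word_deriv_add algebra_simps)
  show ?thesis
    using subset_UNIV[of "Poly_Mapping.keys p"]
    by (induction rule: frag_induction) (simp_all add: 1 lin_diff algebra_simps)
qed

text \<open>The second clause says that the operator kills the relation \<open>x\<^sub>i x\<^sub>j + x\<^sub>j x\<^sub>i\<close>.\<close>

definition deriv_relation :: "nat \<Rightarrow> (nat \<Rightarrow> skew) \<Rightarrow> nat set \<Rightarrow> bool" where
  "deriv_relation n s J \<longleftrightarrow> skew_relation n s \<and>
     (\<forall>i\<in>{1..n}. \<forall>j\<in>{1..n}. i \<noteq> j \<longrightarrow>
        of_bool (i \<in> J) * xvar j + s i * of_bool (j \<in> J) +
        (of_bool (j \<in> J) * xvar i + s j * of_bool (i \<in> J)) = 0)"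

text \<open>By the Leibniz rule, the value of the operator at \<open>r p\<close> or \<open>p r\<close> involves the value of \<open>p\<close> and of
its twist besides the operator at \<open>p\<close>.  All three vanish on the relations, and the induction
carries them along together.\<close>

lemma deriv_relation_kills:
  assumes "deriv_relation n s J" "p \<in> odd_ideal n"
  shows "lin (word_deriv s J) p = 0"
proof -
  have "lin (word_deriv s J) p = 0 \<and> skew_eval p = 0 \<and> lin (word_prod s) p = 0"
    using assms(2)
  proof (induction rule: odd_ideal_induct)
    case (rel i j)
    then have "free_gen i * free_gen j + free_gen j * free_gen i \<in> odd_ideal n"
      using odd_rels_subset_odd_ideal unfolding odd_rels_def by auto
    moreover have "lin (word_deriv s J) (free_gen i * free_gen j + free_gen j * free_gen i) = 0"
      using assms(1) rel
      by (simp add: lin_add free_gen_def mult_single plus_list_def deriv_relation_def word_prod_Cons)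
    moreover have "skew_relation n s"
      using assms(1) by (simp add: deriv_relation_def)
    ultimately show ?case
      using skew_eval_odd_ideal skew_relation_kills by blast
  qed (auto simp: lin_add lin_minus lin_word_prod_mult lin_word_deriv_mult)
  then show ?thesis ..
qed

definition skew_deriv :: "(nat \<Rightarrow> skew) \<Rightarrow> nat set \<Rightarrow> skew \<Rightarrow> skew" where
  "skew_deriv s J f = lin (word_deriv s J) (normal_form f)"

lemma skew_deriv_zero [simp]: "skew_deriv s J 0 = 0"
  and skew_deriv_diff: "skew_deriv s J (f - g) = skew_deriv s J f - skew_deriv s J g"
  by (simp_all add: skew_deriv_def normal_form_diff lin_diff)

lemma skew_deriv_minus: "skew_deriv s J (- f) = - skew_deriv s J f"
  using skew_deriv_diff[of s J 0 f] by simp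

lemma skew_deriv_add: "skew_deriv s J (f + g) = skew_deriv s J f + skew_deriv s J g"
  using skew_deriv_diff[of s J f "- g"] by (simp add: skew_deriv_minus)

lemma skew_deriv_mult:
  assumes "deriv_relation n s J" "f \<in> skew_pol n" "g \<in> skew_pol n"
  shows "skew_deriv s J (f * g) = skew_deriv s J f * g + subst s f * skew_deriv s J g"
  unfolding skew_deriv_def subst_def
  using lin_normal_form_mult[of n, OF deriv_relation_kills, OF assms(1) _ assms(2,3)]
  by (simp add: lin_word_deriv_mult skew_eval_normal_form)

lemma skew_deriv_word:
  assumes "deriv_relation n s J" "w \<in> lists {1..n}"
  shows "skew_deriv s J (word_prod xvar w) = word_deriv s J w"
  using lin_normal_form_eval[OF deriv_relation_kills[OF assms(1)] frag_of_word_closed[OF assms(2)]]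
  by (simp add: skew_deriv_def)

lemma skew_deriv_one: "deriv_relation n s J \<Longrightarrow> skew_deriv s J 1 = 0"
  using skew_deriv_word[of n s J "[]"] by simp

lemma skew_deriv_xvar:
  "deriv_relation n s J \<Longrightarrow> i \<in> {1..n} \<Longrightarrow> skew_deriv s J (xvar i) = of_bool (i \<in> J)"
  using skew_deriv_word[of n s J "[i]"] by (simp add: word_prod_Cons)

lemma skew_deriv_closed:
  assumes "deriv_relation n s J" "f \<in> skew_pol n"
  shows "skew_deriv s J f \<in> skew_pol n"
  unfolding skew_deriv_def
proof (rule lin_closed[OF _ normal_form_closed[OF assms(2)]])
  fix w assume "w \<in> lists {1..n}"
  then show "word_deriv s J w \<in> skew_pol n"
  proof induction
    case (Cons i w)
    with assms(1) show ?case
      by (cases "i \<in> J")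
        (auto simp: deriv_relation_def skew_relation_def
         intro!: skew_pol_add skew_pol_mult word_prod_closed skew_pol_xvar)
  qed simp
qed

text \<open>Existence and uniqueness on the side of the monomial basis turn the definite descriptions of the
operators into concrete maps.\<close>

lemma skew_deriv_unique:
  assumes s: "deriv_relation n s J" and f: "f \<in> skew_pol n"
    and add: "\<And>f g. f \<in> skew_pol n \<Longrightarrow> g \<in> skew_pol n \<Longrightarrow> \<delta> (f + g) = \<delta> f + \<delta> g"
    and mult: "\<And>f g. f \<in> skew_pol n \<Longrightarrow> g \<in> skew_pol n \<Longrightarrow> \<delta> (f * g) = \<delta> f * g + subst s f * \<delta> g"
    and one: "\<delta> 1 = 0" and xvar: "\<And>i. i \<in> {1..n} \<Longrightarrow> \<delta> (xvar i) = of_bool (i \<in> J)"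
  shows "\<delta> f = skew_deriv s J f"
  using f
proof (induction rule: skew_pol_word_induct)
  case zero
  show ?case using add[of 0 0] by simp
next
  case (word w)
  have s': "skew_relation n s" using s by (simp add: deriv_relation_def)
  from word have "\<delta> (word_prod xvar w) = word_deriv s J w"
  proof (induction w)
    case (Cons i w)
    have "word_prod xvar w \<in> skew_pol n"
      using Cons.hyps by (intro word_prod_closed skew_pol_xvar) auto
    with Cons show ?case
      using mult[of "xvar i" "word_prod xvar w"] xvar[of i]
      by (simp add: word_prod_Cons skew_pol_xvar word_prod_closed subst_xvar[OF s'])
  qed (simp add: one)
  with word s show ?case by (simp add: skew_deriv_word)
next
  case (diff f g)
  then show ?case
    using add[of "f - g" g] by (simp add: skew_deriv_diff skew_pol_diff eq_diff_eq)
qed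

lemma alg_endo_to_skew:
  assumes s: "skew_relation n s"
    and v: "\<And>j. j \<in> {1..n} \<Longrightarrow> v j \<in> carrier (odd_pol n)" "\<And>j. j \<in> {1..n} \<Longrightarrow> to_skew (v j) = s j"
    and f: "f \<in> carrier (odd_pol n)"
  shows "alg_endo n v f = from_skew n (subst s (to_skew f))"
proof -
  interpret ring "odd_pol n" by (rule ring_odd_pol)
  let ?P = "\<lambda>\<phi>. \<phi> \<in> extensional (carrier (odd_pol n)) \<and>
     \<phi> \<in> ring_hom (odd_pol n) (odd_pol n) \<and> (\<forall>j\<in>{1..n}. \<phi> (odd_var n j) = v j)"
  let ?\<phi> = "restrict (\<lambda>f. from_skew n (subst s (to_skew f))) (carrier (odd_pol n))"
  have "alg_endo n v = ?\<phi>"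
    unfolding alg_endo_def
  proof (rule the_equality)
    have "?\<phi> \<in> ring_hom (odd_pol n) (odd_pol n)"
      by (rule ring_hom_memI)
         (simp_all add: to_skew_closed from_skew_closed subst_closed[OF s] to_skew_hom subst_add
           subst_mult[OF s] from_skew_hom subst_one[OF s])
    then show "?P ?\<phi>"
      using v by (auto simp: odd_var_closed to_skew_odd_var subst_xvar[OF s] from_skew_to_skew
          simp flip: v(2))
  next
    fix \<phi> assume \<phi>: "?P \<phi>"
    then have hom: "\<phi> \<in> ring_hom (odd_pol n) (odd_pol n)" by blast
    note [simp] = ring_hom_closed[OF hom] from_skew_closed to_skew_hom from_skew_hom
      ring_hom_add[OF hom] ring_hom_mult[OF hom] ring_hom_one[OF hom]
    have "\<phi> f = from_skew n (subst s (to_skew f))" if f: "f \<in> carrier (odd_pol n)" for f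
    proof -
      have "to_skew (\<phi> (from_skew n g)) = subst s g" if "g \<in> skew_pol n" for g
        using s that
      proof (rule subst_unique)
        fix i assume i: "i \<in> {1..n}"
        then have "from_skew n (xvar i) = odd_var n i"
          by (metis from_skew_to_skew odd_var_closed to_skew_odd_var)
        with i \<phi> show "to_skew (\<phi> (from_skew n (xvar i))) = s i" by (simp add: v(2))
      qed simp_all
      from this[of "to_skew f"] f show ?thesis
        by (simp add: to_skew_closed from_skew_to_skew) (metis from_skew_to_skew ring_hom_closed[OF hom])
    qed
    then show "\<phi> = ?\<phi>"
      using \<phi> by (auto simp: extensional_def fun_eq_iff)
  qed
  with f show ?thesis by simp
qed

lemma twisted_derivation_to_skew:
  assumes s: "deriv_relation n s J"
    and \<sigma>: "\<And>f. f \<in> carrier (odd_pol n) \<Longrightarrow> \<sigma> f = from_skew n (subst s (to_skew f))"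
    and f: "f \<in> carrier (odd_pol n)"
  shows "twisted_derivation n \<sigma> J f = from_skew n (skew_deriv s J (to_skew f))"
proof -
  interpret ring "odd_pol n" by (rule ring_odd_pol)
  have s': "skew_relation n s" using s by (simp add: deriv_relation_def)
  let ?P = "\<lambda>D. D \<in> extensional (carrier (odd_pol n)) \<and>
     D \<in> hom (add_monoid (odd_pol n)) (add_monoid (odd_pol n)) \<and>
     D \<one>\<^bsub>odd_pol n\<^esub> = \<zero>\<^bsub>odd_pol n\<^esub> \<and>
     (\<forall>j\<in>{1..n}. D (odd_var n j) = (if j \<in> J then \<one>\<^bsub>odd_pol n\<^esub> else \<zero>\<^bsub>odd_pol n\<^esub>)) \<and>
     (\<forall>f\<in>carrier (odd_pol n). \<forall>g\<in>carrier (odd_pol n).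
        D (f \<otimes>\<^bsub>odd_pol n\<^esub> g) =
          D f \<otimes>\<^bsub>odd_pol n\<^esub> g \<oplus>\<^bsub>odd_pol n\<^esub> \<sigma> f \<otimes>\<^bsub>odd_pol n\<^esub> D g)"
  let ?D = "restrict (\<lambda>f. from_skew n (skew_deriv s J (to_skew f))) (carrier (odd_pol n))"
  note closed = to_skew_closed from_skew_closed subst_closed[OF s'] skew_deriv_closed[OF s] skew_pol_mult
  have "twisted_derivation n \<sigma> J = ?D"
    unfolding twisted_derivation_def
  proof (rule the_equality)
    have "?D \<in> hom (add_monoid (odd_pol n)) (add_monoid (odd_pol n))"
      by (rule homI) (simp_all add: closed to_skew_hom skew_deriv_add from_skew_hom)
    then show "?P ?D"
      by (auto simp: closed odd_var_closed to_skew_odd_var to_skew_hom from_skew_hom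
          skew_deriv_one[OF s] skew_deriv_xvar[OF s] skew_deriv_mult[OF s] \<sigma> from_skew_to_skew)
  next
    fix D assume D: "?P D"
    then have hom: "D \<in> hom (add_monoid (odd_pol n)) (add_monoid (odd_pol n))" by blast
    have cl: "D f \<in> carrier (odd_pol n)" if "f \<in> carrier (odd_pol n)" for f
      using hom_in_carrier[OF hom] that by simp
    have add: "D (f \<oplus>\<^bsub>odd_pol n\<^esub> g) = D f \<oplus>\<^bsub>odd_pol n\<^esub> D g"
      if "f \<in> carrier (odd_pol n)" "g \<in> carrier (odd_pol n)" for f g
      using hom_mult[OF hom] that by simp
    have "D f = from_skew n (skew_deriv s J (to_skew f))" if f: "f \<in> carrier (odd_pol n)" for f
    proof -
      have "to_skew (D (from_skew n g)) = skew_deriv s J g" if "g \<in> skew_pol n" for g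
        using s that
      proof (rule skew_deriv_unique)
        fix i assume i: "i \<in> {1..n}"
        then have "from_skew n (xvar i) = odd_var n i"
          by (metis from_skew_to_skew odd_var_closed to_skew_odd_var)
        with i D show "to_skew (D (from_skew n (xvar i))) = of_bool (i \<in> J)" by (simp add: to_skew_hom)
      qed (use D in \<open>simp_all add: closed cl add from_skew_hom to_skew_hom \<sigma> to_skew_from_skew\<close>)
      from this[of "to_skew f"] f show ?thesis
        by (simp add: to_skew_closed from_skew_to_skew) (metis from_skew_to_skew cl)
    qed
    then show "D = ?D"
      using D by (auto simp: extensional_def fun_eq_iff)
  qed
  with f show ?thesis by simp
qed

abbreviation adj :: "nat \<Rightarrow> nat \<Rightarrow> nat" where
  "adj i \<equiv> Transposition.transpose i (i + 1)"

text \<open>The images of the generators under \<open>s\<^sub>i\<close> and \<open>s\<^sub>n\<^sup>B\<close>.\<close>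

definition s_img :: "nat \<Rightarrow> nat \<Rightarrow> skew" where
  "s_img i j = - xvar (adj i j)"

definition sB_img :: "nat \<Rightarrow> skew" where
  "sB_img j = - xvar j"

lemma deriv_relation_s:
  assumes "i \<in> {1..<n}"
  shows "deriv_relation n (s_img i) {i, i + 1}"
  using assms xvar_anticommute
  by (auto simp: deriv_relation_def skew_relation_def s_img_def skew_pol_xvar skew_pol_minus
      Transposition.transpose_def)

lemma deriv_relation_sB: "deriv_relation n sB_img {n}"
  using xvar_anticommute
  by (auto simp: deriv_relation_def skew_relation_def sB_img_def skew_pol_xvar skew_pol_minus)

lemma odd_demazure_eq_from_skew:
  assumes i: "i \<in> {1..<n}" and f: "f \<in> carrier (odd_pol n)"
  shows "odd_demazure n i f = from_skew n (skew_deriv (s_img i) {i, i + 1} (to_skew f))"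
  unfolding odd_demazure_def
proof (rule twisted_derivation_to_skew[OF deriv_relation_s[OF i] _ f])
  interpret ring "odd_pol n" by (rule ring_odd_pol)
  fix f assume f: "f \<in> carrier (odd_pol n)"
  have cl: "odd_var n (if j = i then i + 1 else if j = i + 1 then i else j) \<in> carrier (odd_pol n)"
    if "j \<in> {1..n}" for j
    using i that by (intro odd_var_closed) auto
  show "odd_s n i f = from_skew n (subst (s_img i) (to_skew f))"
    unfolding odd_s_def
    by (rule alg_endo_to_skew[OF _ _ _ f])
       (use deriv_relation_s[OF i] cl i in
         \<open>auto simp: deriv_relation_def to_skew_a_inv s_img_def to_skew_odd_var
           Transposition.transpose_def\<close>)
qed

lemma odd_demazureB_eq_from_skew:
  assumes f: "f \<in> carrier (odd_pol n)"
  shows "odd_demazureB n f = from_skew n (skew_deriv sB_img {n} (to_skew f))"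
  unfolding odd_demazureB_def
proof (rule twisted_derivation_to_skew[OF deriv_relation_sB _ f])
  interpret ring "odd_pol n" by (rule ring_odd_pol)
  fix f assume f: "f \<in> carrier (odd_pol n)"
  show "odd_sB n f = from_skew n (subst sB_img (to_skew f))"
    unfolding odd_sB_def
    by (rule alg_endo_to_skew[OF _ _ _ f])
       (use deriv_relation_sB[of n] in
         \<open>auto simp: deriv_relation_def to_skew_a_inv sB_img_def to_skew_odd_var odd_var_closed\<close>)
qed

lemma from_skew_eq_zero_iff: "f \<in> skew_pol n \<Longrightarrow> from_skew n f = \<zero>\<^bsub>odd_pol n\<^esub> \<longleftrightarrow> f = 0"
  by (metis from_skew_hom(4) to_skew_from_skew skew_pol_zero)

lemma spinB_sym_eq:
  "spinB_sym n = {f \<in> carrier (odd_pol n).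
     (\<forall>i\<in>{1..<n}. skew_deriv (s_img i) {i, i + 1} (to_skew f) = 0) \<and> skew_deriv sB_img {n} (to_skew f) = 0}"
proof -
  have "odd_demazure n i f = \<zero>\<^bsub>odd_pol n\<^esub> \<longleftrightarrow> skew_deriv (s_img i) {i, i + 1} (to_skew f) = 0"
    if "i \<in> {1..<n}" "f \<in> carrier (odd_pol n)" for i f
    using that
    by (simp only: odd_demazure_eq_from_skew from_skew_eq_zero_iff skew_deriv_closed[OF deriv_relation_s] to_skew_closed)
  moreover have "odd_demazureB n f = \<zero>\<^bsub>odd_pol n\<^esub> \<longleftrightarrow> skew_deriv sB_img {n} (to_skew f) = 0"
    if "f \<in> carrier (odd_pol n)" for f
    using that
    by (simp only: odd_demazureB_eq_from_skew from_skew_eq_zero_iff skew_deriv_closed[OF deriv_relation_sB] to_skew_closed)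
  moreover have "f \<in> spinB_sym n \<longleftrightarrow> f \<in> carrier (odd_pol n) \<and>
      (\<forall>i\<in>{1..<n}. odd_demazure n i f = \<zero>\<^bsub>odd_pol n\<^esub>) \<and> odd_demazureB n f = \<zero>\<^bsub>odd_pol n\<^esub>" for f
    by (auto simp only: spinB_sym_def a_kernel_def' INT_iff Int_iff mem_Collect_eq)
  ultimately show ?thesis by blast
qed

section \<open>The common kernel of the Demazure operators\<close>

lemma swap_sign_double [simp]: "swap_sign (a + a) b = 1" "swap_sign b (a + a) = 1"
  by (simp_all add: swap_sign_add_left swap_sign_add_right)

text \<open>The embedding \<open>t\<^sub>i \<mapsto> x\<^sub>i\<^sup>2\<close> of the commutative polynomial ring.  No signs occur in products of
squares, so it is multiplicative and its image is central.\<close>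

definition sq_embed :: "mpoly \<Rightarrow> skew" where
  "sq_embed = lin (\<lambda>m. xmonom (m + m))"

lemma sq_embed_zero [simp]: "sq_embed 0 = 0"
  and sq_embed_one [simp]: "sq_embed 1 = 1"
  and sq_embed_single: "sq_embed (Poly_Mapping.single m c) = of_int c * xmonom (m + m)"
  and sq_embed_add: "sq_embed (p + q) = sq_embed p + sq_embed q"
  and sq_embed_diff: "sq_embed (p - q) = sq_embed p - sq_embed q"
  by (simp_all add: sq_embed_def lin_add lin_diff)

lemma sq_embed_mult: "sq_embed (p * q) = sq_embed p * sq_embed q"
  unfolding sq_embed_def by (rule lin_mult) (simp add: xmonom_mult ac_simps)

lemma sq_embed_central: "sq_embed p * f = f * sq_embed p"
proof -
  have 1: "xmonom (m + m) * f = f * xmonom (m + m)" for m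
    by (induction f rule: skew_induct_UNIV)
       (simp_all add: xmonom_mult left_diff_distrib right_diff_distrib add.commute)
  show ?thesis
    using subset_UNIV[of "Poly_Mapping.keys p"]
    by (induction rule: frag_induction)
       (simp_all add: sq_embed_single 1 sq_embed_diff left_diff_distrib right_diff_distrib)
qed

lemma double_eq_iff: "m + m = k + k \<longleftrightarrow> m = (k :: nat \<Rightarrow>\<^sub>0 nat)"
proof
  assume "m + m = k + k"
  then have "2 * Poly_Mapping.lookup m j = 2 * Poly_Mapping.lookup k j" for j
    by (metis lookup_add mult_2)
  then show "m = k" by (intro poly_mapping_eqI) simp
qed simp

lemma xcoeff_sq_embed: "xcoeff (sq_embed p) (m + m) = Poly_Mapping.lookup p m"
  using subset_UNIV[of "Poly_Mapping.keys p"]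
  by (induction rule: frag_induction)
     (simp_all add: sq_embed_single sq_embed_diff lookup_minus xcoeff_xmonom double_eq_iff)

lemma sq_embed_eq_iff: "sq_embed p = sq_embed q \<longleftrightarrow> p = q"
  by (metis xcoeff_sq_embed poly_mapping_eqI)

text \<open>Multiplication by a polynomial in the squares causes no sign changes, so on coefficients it is
multiplication in the commutative polynomial ring, which is a domain.  Hence such elements are not
zero divisors.\<close>

lemma coeffs_sq_embed_mult: "coeffs (sq_embed p * f) = coeffs (sq_embed p) * coeffs f"
proof -
  have 1: "coeffs (xmonom (m + m) * f) = coeffs (xmonom (m + m)) * coeffs f" for m
    by (induction f rule: skew_induct_UNIV)
       (simp_all add: xmonom_mult right_diff_distrib minus_skew.rep_eq zero_skew.rep_eq,
        simp add: xmonom_def Skew_inverse mult_single)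
  show ?thesis
    using subset_UNIV[of "Poly_Mapping.keys p"]
    by (induction rule: frag_induction)
       (simp_all add: sq_embed_single 1 sq_embed_diff left_diff_distrib minus_skew.rep_eq zero_skew.rep_eq)
qed

lemma sq_embed_mult_eq_0:
  assumes "sq_embed p * f = 0" "p \<noteq> 0"
  shows "f = 0"
proof -
  have "coeffs (sq_embed p) * coeffs f = 0"
    using assms(1) by (simp add: zero_skew.rep_eq flip: coeffs_sq_embed_mult)
  moreover have "coeffs (sq_embed p) \<noteq> 0"
    using assms(2) sq_embed_eq_iff[of p 0] by (metis coeffs_inverse sq_embed_zero zero_skew_def)
  ultimately have "coeffs f = 0" by simp
  then show ?thesis by (metis coeffs_inverse zero_skew_def)
qed

abbreviation mpoly_in :: "nat \<Rightarrow> mpoly set" where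
  "mpoly_in n \<equiv> {p. Poly_Mapping.keys p \<subseteq> exps_in n}"

lemma sq_embed_var: "sq_embed (mpoly_var i) = xvar i * xvar i"
  by (simp add: mpoly_var_def sq_embed_single xvar_def xmonom_mult swap_sign_def inversions_single_single)

lemma exps_in_double: "m + m \<in> exps_in n \<longleftrightarrow> m \<in> exps_in n"
  by (auto simp: exps_in_def in_keys_iff lookup_add subset_iff)

lemma sq_embed_closed:
  assumes "p \<in> mpoly_in n"
  shows "sq_embed p \<in> skew_pol n"
proof -
  from assms have "Poly_Mapping.keys p \<subseteq> exps_in n" by simp
  then show ?thesis
    by (induction rule: frag_induction)
       (simp_all add: sq_embed_single sq_embed_diff skew_pol_diff skew_pol_xmonom exps_in_double)
qed

lemma double_exp:
  assumes "\<And>j. even (Poly_Mapping.lookup m j)"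
  obtains h where "m = h + (h :: nat \<Rightarrow>\<^sub>0 nat)"
proof
  show "m = Poly_Mapping.map (\<lambda>x. x div 2) m + Poly_Mapping.map (\<lambda>x. x div 2) m"
  proof (rule poly_mapping_eqI)
    fix j
    have "Poly_Mapping.lookup m j = 2 * (Poly_Mapping.lookup m j div 2)" using assms by simp
    then show "Poly_Mapping.lookup m j = Poly_Mapping.lookup
        (Poly_Mapping.map (\<lambda>x. x div 2) m + Poly_Mapping.map (\<lambda>x. x div 2) m) j"
      by (simp only: lookup_add map.rep_eq when_def) (auto simp flip: mult_2)
  qed
qed

lemma even_eq_sq_embed:
  assumes "f \<in> skew_pol n" and "\<And>m j. xcoeff f m \<noteq> 0 \<Longrightarrow> even (Poly_Mapping.lookup m j)"
  obtains p where "p \<in> mpoly_in n" "f = sq_embed p"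
proof -
  have "Poly_Mapping.keys (coeffs f) \<subseteq> {h + h |h. h \<in> exps_in n}"
  proof
    fix m assume m: "m \<in> Poly_Mapping.keys (coeffs f)"
    then obtain h where h: "m = h + h"
      using assms(2) double_exp by (metis in_keys_iff)
    moreover have "m \<in> exps_in n" using assms(1) m by (auto simp: skew_pol_def)
    ultimately show "m \<in> {h + h |h. h \<in> exps_in n}" by (auto simp: exps_in_double)
  qed
  then have "\<exists>p. p \<in> mpoly_in n \<and> f = sq_embed p"
  proof (induction rule: skew_induct)
    case zero
    show ?case by (rule exI[of _ 0]) simp
  next
    case (xmonom a)
    then obtain h where "a = h + h" "h \<in> exps_in n" by blast
    then show ?case by (intro exI[of _ "frag_of h"]) (simp add: sq_embed_single)
  next
    case (diff f g)
    then obtain p q where pq: "p \<in> mpoly_in n" "f = sq_embed p" "q \<in> mpoly_in n" "g = sq_embed q" by blast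
    then show ?case
      using keys_diff[of p q] by (intro exI[of _ "p - q"]) (auto simp: sq_embed_diff)
  qed
  then show ?thesis using that by blast
qed

lemma xmonom_double_word: "xmonom (word_exp w + word_exp w) = word_prod (\<lambda>j. xvar j * xvar j) w"
proof (induction w)
  case (Cons i w)
  have "xmonom (word_exp (i # w) + word_exp (i # w)) = sq_embed (mpoly_var i * frag_of (word_exp w))"
    by (simp add: sq_embed_single mpoly_var_def mult_single)
  also have "\<dots> = xvar i * xvar i * xmonom (word_exp w + word_exp w)"
    by (simp add: sq_embed_mult sq_embed_var sq_embed_single)
  finally show ?case using Cons by (simp add: word_prod_Cons)
qed simp

definition perm_exp :: "(nat \<Rightarrow> nat) \<Rightarrow> (nat \<Rightarrow>\<^sub>0 nat) \<Rightarrow> (nat \<Rightarrow>\<^sub>0 nat)" where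
  "perm_exp \<pi> m = (\<Sum>j\<in>Poly_Mapping.keys m. Poly_Mapping.single (\<pi> j) (Poly_Mapping.lookup m j))"

lemma perm_exp_add: "perm_exp \<pi> (a + b) = perm_exp \<pi> a + perm_exp \<pi> b"
  unfolding perm_exp_def by (rule setsum_keys_plus_distrib) (simp_all add: single_add)

lemma perm_exp_zero [simp]: "perm_exp \<pi> 0 = 0"
  by (simp add: perm_exp_def)

lemma perm_exp_word_exp: "perm_exp \<pi> (word_exp w) = word_exp (map \<pi> w)"
  by (induction w) (simp_all add: perm_exp_add, simp add: perm_exp_def)

lemma lookup_perm_exp:
  assumes "inj \<pi>"
  shows "Poly_Mapping.lookup (perm_exp \<pi> m) (\<pi> j) = Poly_Mapping.lookup m j"
proof -
  have "Poly_Mapping.lookup (word_exp (map \<pi> w)) (\<pi> j) = Poly_Mapping.lookup (word_exp w) j" for w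
    using assms by (induction w) (simp_all add: lookup_add lookup_single inj_eq)
  then show ?thesis
    using word_exp_surj[of m] perm_exp_word_exp by metis
qed

definition perm_act :: "(nat \<Rightarrow> nat) \<Rightarrow> mpoly \<Rightarrow> mpoly" where
  "perm_act \<pi> = lin (\<lambda>m. frag_of (perm_exp \<pi> m))"

lemma perm_act_diff: "perm_act \<pi> (p - q) = perm_act \<pi> p - perm_act \<pi> q"
  and perm_act_zero [simp]: "perm_act \<pi> 0 = 0"
  and perm_act_frag_of [simp]: "perm_act \<pi> (frag_of m) = frag_of (perm_exp \<pi> m)"
  by (simp_all add: perm_act_def lin_diff)

text \<open>A substitution that permutes the variables up to sign permutes their squares without signs.\<close>

lemma subst_sq_embed:
  assumes s: "skew_relation n s" "\<And>j. j \<in> {1..n} \<Longrightarrow> s j * s j = xvar (\<pi> j) * xvar (\<pi> j)"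
    and p: "p \<in> mpoly_in n"
  shows "subst s (sq_embed p) = sq_embed (perm_act \<pi> p)"
proof -
  have 1: "subst s (xmonom (m + m)) = xmonom (perm_exp \<pi> m + perm_exp \<pi> m)" if "m \<in> exps_in n" for m
  proof -
    obtain w where w: "m = word_exp w" using word_exp_surj by metis
    with that have "w \<in> lists {1..n}" by (simp add: exps_in_word_exp)
    then have "subst s (word_prod (\<lambda>j. xvar j * xvar j) w) = word_prod (\<lambda>j. xvar j * xvar j) (map \<pi> w)"
    proof (induction w)
      case (Cons i w)
      have "word_prod (\<lambda>j. xvar j * xvar j) w \<in> skew_pol n"
        using Cons.hyps by (intro word_prod_closed skew_pol_mult skew_pol_xvar) auto
      with Cons show ?case
        by (simp add: word_prod_Cons subst_mult[OF s(1)] subst_xvar[OF s(1)] skew_pol_mult skew_pol_xvar s(2))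
    qed (simp add: subst_one[OF s(1)])
    then show ?thesis
      by (simp add: w perm_exp_word_exp flip: xmonom_double_word)
  qed
  from p have "Poly_Mapping.keys p \<subseteq> exps_in n" by simp
  then show ?thesis
    by (induction rule: frag_induction)
       (simp_all add: sq_embed_single 1 sq_embed_diff subst_diff perm_act_diff)
qed

text \<open>The map \<open>f \<mapsto> u f - s(f) u\<close> satisfies the twisted Leibniz rule for every \<open>u\<close>, because
\<open>u f g - s(f) s(g) u = (u f - s(f) u) g + s(f) (u g - s(g) u)\<close>.  So does a central multiple of a
twisted derivation, and two such maps agree once they agree on the generators.\<close>

lemma deriv_mult_commutator:
  assumes s: "deriv_relation n s J" and c: "\<And>f. c * f = f * c"
    and u: "\<And>j. j \<in> {1..n} \<Longrightarrow> u * xvar j - s j * u = c * of_bool (j \<in> J)"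
    and f: "f \<in> skew_pol n"
  shows "c * skew_deriv s J f = u * f - subst s f * u"
  using f
proof (induction rule: skew_pol_word_induct)
  case (word w)
  then have "c * word_deriv s J w = u * word_prod xvar w - word_prod s w * u"
  proof (induction w)
    case (Cons j w)
    have "c * word_deriv s J (j # w) = (c * of_bool (j \<in> J)) * word_prod xvar w + (c * s j) * word_deriv s J w"
      by (simp add: algebra_simps)
    also have "\<dots> = (u * xvar j - s j * u) * word_prod xvar w + s j * (c * word_deriv s J w)"
      using u[of j] Cons.hyps by (simp only: c[of "s j"] mult.assoc)
    also have "\<dots> = u * word_prod xvar (j # w) - word_prod s (j # w) * u"
      by (simp add: Cons.IH word_prod_Cons algebra_simps)
    finally show ?case .
  qed simp
  with word s show ?case
    by (simp add: skew_deriv_word subst_word[of n] deriv_relation_def)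
qed (simp_all add: skew_deriv_diff subst_diff algebra_simps)

text \<open>The central factor is a nonzero polynomial in the squares, so it can be cancelled.  The kernel of a
Demazure operator becomes the solution set of a commutation rule.\<close>

lemma deriv_eq_0_iff:
  assumes "deriv_relation n s J" and "\<gamma> \<noteq> 0"
    and "\<And>j. j \<in> {1..n} \<Longrightarrow> u * xvar j - s j * u = sq_embed \<gamma> * of_bool (j \<in> J)"
    and "f \<in> skew_pol n"
  shows "skew_deriv s J f = 0 \<longleftrightarrow> u * f = subst s f * u"
proof -
  have "sq_embed \<gamma> * skew_deriv s J f = u * f - subst s f * u"
    using assms(1) sq_embed_central assms(3,4) by (rule deriv_mult_commutator)
  then show ?thesis using sq_embed_mult_eq_0[OF _ assms(2), of "skew_deriv s J f"] by auto
qed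

lemma mpoly_var_neq: "i \<noteq> j \<Longrightarrow> mpoly_var i - mpoly_var j \<noteq> 0" "mpoly_var i + mpoly_var j \<noteq> 0"
proof -
  show "mpoly_var i - mpoly_var j \<noteq> 0" if "i \<noteq> j"
  proof -
    have "unit_exp i \<noteq> unit_exp j"
      using that by (metis lookup_single_eq lookup_single_not_eq zero_neq_one)
    then show ?thesis by (simp add: mpoly_var_def frag_of_eq)
  qed
  have "Poly_Mapping.lookup (mpoly_var i + mpoly_var j) (unit_exp i) \<noteq> 0"
    by (auto simp: mpoly_var_def lookup_add lookup_single when_def)
  then show "mpoly_var i + mpoly_var j \<noteq> 0" by (metis lookup_zero)
qed

lemma diff_square_anticommuting:
  fixes x y :: "'a::ring_1"
  assumes "y * x + x * y = 0"
  shows "(y - x) * (y - x) = x * x + y * y"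
proof -
  have "(y - x) * (y - x) = x * x + y * y - (y * x + x * y)" by (simp add: algebra_simps)
  with assms show ?thesis by simp
qed

text \<open>For \<open>u = x\<^sub>i\<^sub>+\<^sub>1 - x\<^sub>i\<close> the commutator formula reads
\<open>(x\<^sub>i\<^sub>+\<^sub>1\<^sup>2 - x\<^sub>i\<^sup>2) \<partial>\<^sub>i(f) = u f - s\<^sub>i(f) u\<close>, the odd analogue of the divided difference.\<close>

lemma skew_deriv_s_eq_0_iff:
  assumes i: "i \<in> {1..<n}" and f: "f \<in> skew_pol n"
  shows "skew_deriv (s_img i) {i, i + 1} f = 0 \<longleftrightarrow>
    (xvar (i + 1) - xvar i) * f = subst (s_img i) f * (xvar (i + 1) - xvar i)"
proof (rule deriv_eq_0_iff[OF deriv_relation_s[OF i] _ _ f])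
  show "mpoly_var (i + 1) - mpoly_var i \<noteq> 0" by (rule mpoly_var_neq) simp
  fix j assume "j \<in> {1..n}"
  have "(xvar (i + 1) - xvar i) * xvar j + xvar j * (xvar (i + 1) - xvar i) = 0" if "j \<noteq> i" "j \<noteq> i + 1"
  proof -
    have "(xvar (i + 1) - xvar i) * xvar j + xvar j * (xvar (i + 1) - xvar i) =
        (xvar (i + 1) * xvar j + xvar j * xvar (i + 1)) - (xvar i * xvar j + xvar j * xvar i)"
      by (simp add: algebra_simps)
    with that show ?thesis by (simp only: xvar_anticommute not_sym[OF that(1)] not_sym[OF that(2)]
          diff_self not_False_eq_True)
  qed
  then show "(xvar (i + 1) - xvar i) * xvar j - s_img i j * (xvar (i + 1) - xvar i) =
      sq_embed (mpoly_var (i + 1) - mpoly_var i) * of_bool (j \<in> {i, i + 1})"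
    by (auto simp: s_img_def sq_embed_diff sq_embed_var algebra_simps)
qed

text \<open>For \<open>u = x\<^sub>n\<close> the formula reads \<open>2 x\<^sub>n\<^sup>2 \<partial>\<^sub>n\<^sup>B(f) = x\<^sub>n f - s\<^sub>n\<^sup>B(f) x\<^sub>n\<close>.\<close>

lemma skew_deriv_sB_eq_0_iff:
  assumes "n \<ge> 1" and f: "f \<in> skew_pol n"
  shows "skew_deriv sB_img {n} f = 0 \<longleftrightarrow> xvar n * f = subst sB_img f * xvar n"
proof (rule deriv_eq_0_iff[OF deriv_relation_sB _ _ f])
  show "mpoly_var n + mpoly_var n \<noteq> 0" by (rule mpoly_var_neq)
  fix j assume "j \<in> {1..n}"
  show "xvar n * xvar j - sB_img j * xvar n = sq_embed (mpoly_var n + mpoly_var n) * of_bool (j \<in> {n})"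
    using xvar_anticommute[of n j] unfolding sB_img_def sq_embed_add sq_embed_var by (cases "j = n") auto
qed

text \<open>For statements about which monomials occur, this replaces the computation of signs.\<close>

lemma word_prod_xvar_monomial:
  "xcoeff (word_prod xvar w) m \<noteq> 0 \<Longrightarrow> m = word_exp w"
proof (induction w arbitrary: m)
  case (Cons i w)
  obtain b where b: "m = unit_exp i + b"
    using Cons.prems xcoeff_xmonom_times_eq_0(1)[of m "unit_exp i" "word_prod xvar w"]
    by (auto simp: word_prod_Cons xvar_def[of i])
  then have "xcoeff (word_prod xvar w) b \<noteq> 0"
    using Cons.prems by (auto simp: word_prod_Cons xvar_def[of i] xcoeff_xmonom_times)
  with b Cons.IH show ?case by simp
qed (simp add: one_skew.rep_eq lookup_one when_def split: if_splits)

lemma word_prod_minus: "word_prod (\<lambda>j. - v j) w = (- 1) ^ length w * word_prod v w"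
proof (induction w)
  case (Cons i w)
  then show ?case by (cases "even (length w)") (simp_all add: word_prod_Cons)
qed simp

lemma word_prod_comp: "word_prod (\<lambda>j. v (g j)) w = word_prod v (map g w)"
  by (simp add: word_prod_def o_def)

lemma xmonom_eq_word_prod:
  assumes "a \<in> exps_in n"
  obtains w where "w \<in> lists {1..n}" "word_exp w = a" "xmonom a = word_prod xvar w"
  using assms sorted_word[of a] exps_in_word_exp[of "sorted_word a" n] word_prod_sorted[of "sorted_word a"]
  by (metis that)

lemma xcoeff_minus_one_power [simp]: "xcoeff ((- 1) ^ k * f) m = (- 1) ^ k * xcoeff f m"
  using xcoeff_of_int_times[of "(- 1) ^ k" f m] by simp

lemma subst_s_even:
  assumes i: "i \<in> {1..<n}" and f: "f \<in> skew_pol n"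
    and even: "\<And>m. xcoeff f m \<noteq> 0 \<Longrightarrow> even (Poly_Mapping.lookup m (i + 1))"
    and m: "xcoeff (subst (s_img i) f) m \<noteq> 0"
  shows "even (Poly_Mapping.lookup m i)"
proof -
  have s: "skew_relation n (s_img i)" using deriv_relation_s[OF i] by (simp add: deriv_relation_def)
  have "Poly_Mapping.keys (coeffs f) \<subseteq> {m \<in> exps_in n. even (Poly_Mapping.lookup m (i + 1))}"
    using f even by (auto simp: skew_pol_def in_keys_iff)
  then have "\<forall>m. xcoeff (subst (s_img i) f) m \<noteq> 0 \<longrightarrow> even (Poly_Mapping.lookup m i)"
  proof (induction rule: skew_induct)
    case (xmonom a)
    then obtain w where w: "w \<in> lists {1..n}" "word_exp w = a" "xmonom a = word_prod xvar w"
      using xmonom_eq_word_prod by blast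
    have inj: "inj (adj i)" by (rule inj_transpose)
    have "subst (s_img i) (xmonom a) = (- 1) ^ length w * word_prod xvar (map (adj i) w)"
      unfolding w(3) subst_word[OF s w(1)] s_img_def word_prod_minus
      by (simp only: word_prod_comp[of xvar "adj i"])
    moreover have "Poly_Mapping.lookup (word_exp (map (adj i) w)) i = Poly_Mapping.lookup a (i + 1)"
      using lookup_perm_exp[OF inj, of a "i + 1"] unfolding w(2)[symmetric] perm_exp_word_exp by simp
    ultimately show ?case
      using xmonom word_prod_xvar_monomial[of "map (adj i) w"] by auto
  next
    case (diff f g)
    then show ?case by (auto simp: subst_diff) (metis diff_0_right)
  qed simp
  with m show ?thesis by blast
qed

lemma xcoeff_xvar_left_eq_0:
  "(\<And>m'. m = m' + unit_exp i \<Longrightarrow> xcoeff f m' = 0) \<Longrightarrow> xcoeff (xvar i * f) m = 0"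
  using xcoeff_xmonom_times_eq_0(1)[of m "unit_exp i" f] xcoeff_xmonom_times[of "unit_exp i" f]
  unfolding xvar_def by (metis add.commute mult_zero_right)

lemma xcoeff_xvar_right_eq_0:
  "(\<And>m'. m = m' + unit_exp i \<Longrightarrow> xcoeff f m' = 0) \<Longrightarrow> xcoeff (f * xvar i) m = 0"
  using xcoeff_xmonom_times_eq_0(2)[of m "unit_exp i" f] xcoeff_times_xmonom[of f "unit_exp i"]
  unfolding xvar_def by (metis add.commute mult_zero_right)

text \<open>Parity spreads from \<open>x\<^sub>i\<^sub>+\<^sub>1\<close> to \<open>x\<^sub>i\<close>.  Write \<open>a = x\<^sub>i\<close>, \<open>b = x\<^sub>i\<^sub>+\<^sub>1\<close> and \<open>u = b - a\<close>.  Multiplying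
\<open>u f = s\<^sub>i(f) u\<close> by \<open>u\<close> on the right gives \<open>u f u = s\<^sub>i(f) (a\<^sup>2 + b\<^sup>2)\<close>, as \<open>a b + b a = 0\<close>.  At
monomials that are odd in \<open>a\<close> and even in \<open>b\<close>, the terms \<open>a f b\<close>, \<open>b f a\<close> and the right-hand side
do not contribute, because \<open>f\<close> is even in \<open>b\<close> and hence \<open>s\<^sub>i(f)\<close> is even in \<open>a\<close>.  What remains is
\<open>a f a + b f b = 0\<close>: up to sign, the coefficient of \<open>f\<close> at such a monomial is unchanged when
\<open>b\<^sup>2\<close> is exchanged for \<open>a\<^sup>2\<close>.  Repeating the exchange until \<open>b\<close> is used up shows that it is \<open>0\<close>.\<close>

lemma kernel_s_even:
  assumes i: "i \<in> {1..<n}" and f: "f \<in> skew_pol n"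
    and even: "\<And>m. xcoeff f m \<noteq> 0 \<Longrightarrow> even (Poly_Mapping.lookup m (i + 1))"
    and ker: "skew_deriv (s_img i) {i, i + 1} f = 0"
    and m: "xcoeff f m \<noteq> 0"
  shows "even (Poly_Mapping.lookup m i)"
proof -
  let ?a = "xvar i" and ?b = "xvar (i + 1)" and ?g = "subst (s_img i) f"
  let ?u = "?b - ?a"
  have "?u * f * ?u = ?g * (?u * ?u)"
  proof -
    have "?u * f = ?g * ?u" using skew_deriv_s_eq_0_iff[OF i f] ker by blast
    then show ?thesis by (simp only: mult.assoc)
  qed
  also have "?u * ?u = ?a * ?a + ?b * ?b"
    by (rule diff_square_anticommuting) (rule xvar_anticommute, simp)
  finally have eq: "?b * f * ?b + ?a * f * ?a = ?g * ?a * ?a + ?g * ?b * ?b + ?a * f * ?b + ?b * f * ?a"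
    by (simp add: algebra_simps)
  have "xcoeff f m = 0" if "odd (Poly_Mapping.lookup m i)" for m
    using that
  proof (induction "Poly_Mapping.lookup m (i + 1)" arbitrary: m rule: less_induct)
    case less
    \<comment> \<open>At this monomial the term \<open>a f a\<close> has the coefficient of \<open>f\<close> at \<open>m\<close> up to sign,
      and \<open>b f b\<close> the one at \<open>m\<close> after exchanging \<open>b\<^sup>2\<close> for \<open>a\<^sup>2\<close>.\<close>
    let ?M = "m + unit_exp i + unit_exp i"
    have even': "even (Poly_Mapping.lookup m' i)" if "xcoeff ?g m' \<noteq> 0" for m'
      using subst_s_even[OF i f even that] .
    show ?case
    proof (cases "even (Poly_Mapping.lookup m (i + 1))")
      case False
      then show ?thesis using even by blast
    next
      case True
      have *: "Poly_Mapping.lookup ?M i = Poly_Mapping.lookup m i + 2"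
        "Poly_Mapping.lookup ?M (i + 1) = Poly_Mapping.lookup m (i + 1)"
        by (simp_all add: lookup_add lookup_single)
      have "xcoeff (?b * f * ?b) ?M = 0"
      proof (intro xcoeff_xvar_right_eq_0 xcoeff_xvar_left_eq_0)
        fix m1 m2 assume "?M = m1 + unit_exp (i + 1)" "m1 = m2 + unit_exp (i + 1)"
        then have M: "?M = m2 + unit_exp (i + 1) + unit_exp (i + 1)" by simp
        have "Poly_Mapping.lookup m2 (i + 1) < Poly_Mapping.lookup m (i + 1)"
          "Poly_Mapping.lookup m2 i = Poly_Mapping.lookup m i + 2"
          using * unfolding M by (simp_all add: lookup_add lookup_single)
        with less show "xcoeff f m2 = 0" by simp
      qed
      moreover have "xcoeff (?a * f * ?b) ?M = 0"
      proof (intro xcoeff_xvar_right_eq_0 xcoeff_xvar_left_eq_0)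
        fix m1 m2 assume "?M = m1 + unit_exp (i + 1)" "m1 = m2 + unit_exp i"
        then have M: "?M = m2 + unit_exp i + unit_exp (i + 1)" by simp
        have "Poly_Mapping.lookup m2 (i + 1) + 1 = Poly_Mapping.lookup m (i + 1)"
          using *(2) unfolding M by (simp add: lookup_add lookup_single)
        with True even[of m2] show "xcoeff f m2 = 0" by presburger
      qed
      moreover have "xcoeff (?b * f * ?a) ?M = 0"
      proof (intro xcoeff_xvar_right_eq_0 xcoeff_xvar_left_eq_0)
        fix m1 m2 assume "?M = m1 + unit_exp i" "m1 = m2 + unit_exp (i + 1)"
        then have M: "?M = m2 + unit_exp (i + 1) + unit_exp i" by simp
        have "Poly_Mapping.lookup m2 (i + 1) + 1 = Poly_Mapping.lookup m (i + 1)"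
          using *(2) unfolding M by (simp add: lookup_add lookup_single)
        with True even[of m2] show "xcoeff f m2 = 0" by presburger
      qed
      moreover have "xcoeff (?g * xvar k * xvar k) ?M = 0" for k
      proof (intro xcoeff_xvar_right_eq_0)
        fix m1 m2 assume "?M = m1 + unit_exp k" "m1 = m2 + unit_exp k"
        then have M: "?M = m2 + unit_exp k + unit_exp k" by simp
        have "even (Poly_Mapping.lookup m2 i) = even (Poly_Mapping.lookup m i)"
          using arg_cong[OF *(1), of even] unfolding M
          by (cases "even (Poly_Mapping.lookup (unit_exp k) i)") (auto simp: lookup_add)
        with less.prems even' show "xcoeff ?g m2 = 0" by blast
      qed
      ultimately have "xcoeff (?a * f * ?a) ?M = 0"
        using arg_cong[OF eq, of "\<lambda>f. xcoeff f ?M"] by (simp only: xcoeff_add)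
      moreover have "\<bar>xcoeff (?a * f * ?a) ?M\<bar> = \<bar>xcoeff f m\<bar>"
        using xcoeff_times_xmonom[of "?a * f" "unit_exp i" "m + unit_exp i"]
          xcoeff_xmonom_times[of "unit_exp i" f m]
        by (simp add: xvar_def abs_mult add.commute)
      ultimately show ?thesis by simp
    qed
  qed
  with m show ?thesis by blast
qed

lemma xcoeff_subst_sB:
  assumes "f \<in> skew_pol n"
  shows "xcoeff (subst sB_img f) m = (- 1) ^ (\<Sum>j\<in>Poly_Mapping.keys m. Poly_Mapping.lookup m j) * xcoeff f m"
  using assms
proof (induction rule: skew_pol_induct)
  case (xmonom a)
  then obtain w where w: "w \<in> lists {1..n}" "word_exp w = a" "xmonom a = word_prod xvar w"
    using xmonom_eq_word_prod by blast
  have s: "skew_relation n sB_img" using deriv_relation_sB[of n] by (simp add: deriv_relation_def)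
  have "subst sB_img (xmonom a) = (- 1) ^ length w * word_prod xvar w"
    unfolding w(3) subst_word[OF s w(1)] sB_img_def word_prod_minus ..
  moreover have "length w = (\<Sum>j\<in>Poly_Mapping.keys a. Poly_Mapping.lookup a j)"
    using size_multiset_overloaded_eq[of "mset w"] w(2) keys_word_exp[of w]
    by (auto simp: lookup_word_exp)
  ultimately show ?case by (simp add: xcoeff_xmonom flip: w(3))
qed (simp_all add: subst_diff algebra_simps)

text \<open>On a monomial of degree \<open>d\<close> the map \<open>s\<^sub>n\<^sup>B\<close> is the sign \<open>(-1)\<^sup>d\<close>, whereas moving \<open>x\<^sub>n\<close> from the left
to its place gives the sign of the degree in \<open>x\<^sub>1, \<dots>, x\<^sub>n\<^sub>-\<^sub>1\<close>.  These signs agree exactly when the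
exponent of \<open>x\<^sub>n\<close> is even.\<close>

lemma kernel_sB_even:
  assumes n: "n \<ge> 1" and f: "f \<in> skew_pol n"
    and ker: "skew_deriv sB_img {n} f = 0"
    and m: "xcoeff f m \<noteq> 0"
  shows "even (Poly_Mapping.lookup m n)"
proof (rule ccontr)
  assume odd: "odd (Poly_Mapping.lookup m n)"
  from m f have mn: "m \<in> exps_in n" by (auto simp: skew_pol_iff)
  let ?d = "\<Sum>j\<in>Poly_Mapping.keys m. Poly_Mapping.lookup m j"
  have "xcoeff (xvar n * f) (unit_exp n + m) = (- 1) ^ count_below n m * xcoeff f m"
    by (simp add: xvar_def xcoeff_xmonom_times swap_sign_def inversions_def)
  moreover have "xcoeff (subst sB_img f * xvar n) (m + unit_exp n) = (- 1) ^ ?d * xcoeff f m"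
  proof -
    have "inversions m (unit_exp n) = 0"
      using mn by (auto simp: inversions_def count_below_def exps_in_def)
    then show ?thesis
      by (simp add: xvar_def xcoeff_times_xmonom swap_sign_def xcoeff_subst_sB[OF f])
  qed
  ultimately have "(- 1) ^ count_below n m * xcoeff f m = (- 1) ^ ?d * xcoeff f m"
    using ker skew_deriv_sB_eq_0_iff[OF n f] by (metis add.commute)
  with m have "even (count_below n m) = even ?d"
    by (cases "even (count_below n m)"; cases "even ?d") auto
  moreover have "?d = count_below n m + Poly_Mapping.lookup m n"
  proof -
    have "?d = (\<Sum>j\<in>insert n (Poly_Mapping.keys m). Poly_Mapping.lookup m j)"
      by (rule sum.mono_neutral_left) (auto simp: in_keys_iff)
    also have "\<dots> = Poly_Mapping.lookup m n + (\<Sum>j\<in>Poly_Mapping.keys m - {n}. Poly_Mapping.lookup m j)"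
      by (rule sum.insert_remove) simp
    also have "(\<Sum>j\<in>Poly_Mapping.keys m - {n}. Poly_Mapping.lookup m j) = count_below n m"
      unfolding count_below_def
      by (rule sum.mono_neutral_cong_left) (use mn in \<open>auto simp: exps_in_def\<close>)
    finally show ?thesis by simp
  qed
  ultimately show False using odd by simp
qed

text \<open>Evenness starts at \<open>x\<^sub>n\<close>, by the type B operator, and descends to \<open>x\<^sub>1\<close> along the others.\<close>

lemma kernel_even:
  assumes n: "n \<ge> 1" and f: "f \<in> skew_pol n"
    and s: "\<And>i. i \<in> {1..<n} \<Longrightarrow> skew_deriv (s_img i) {i, i + 1} f = 0"
    and sB: "skew_deriv sB_img {n} f = 0"
    and m: "xcoeff f m \<noteq> 0"
  shows "even (Poly_Mapping.lookup m j)"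
proof (cases "j \<in> {1..n}")
  case True
  then have "j \<le> n" "1 \<le> j" by auto
  then have "\<forall>m. xcoeff f m \<noteq> 0 \<longrightarrow> even (Poly_Mapping.lookup m j)"
  proof (induction j rule: inc_induct)
    case base
    then show ?case using kernel_sB_even[OF n f sB] by blast
  next
    case (step j)
    then show ?case using kernel_s_even[of j n f] f s[of j] by auto
  qed
  with m show ?thesis by blast
next
  case False
  with m f have "Poly_Mapping.lookup m j = 0"
    by (auto simp: skew_pol_iff exps_in_def in_keys_iff subset_iff)
  then show ?thesis by simp
qed

text \<open>A polynomial \<open>f\<close> in the squares is central, so that \<open>u f = s\<^sub>i(f) u\<close> means \<open>(f - s\<^sub>i(f)) u = 0\<close>;
multiplying by \<open>u\<close> replaces \<open>u\<close> by the square polynomial \<open>x\<^sub>i\<^sup>2 + x\<^sub>i\<^sub>+\<^sub>1\<^sup>2\<close>, which cancels.\<close>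

lemma skew_deriv_s_sq_embed:
  assumes i: "i \<in> {1..<n}" and p: "p \<in> mpoly_in n"
  shows "skew_deriv (s_img i) {i, i + 1} (sq_embed p) = 0 \<longleftrightarrow> perm_act (adj i) p = p"
proof -
  let ?u = "xvar (i + 1) - xvar i" and ?q = "perm_act (adj i) p"
  have "subst (s_img i) (sq_embed p) = sq_embed ?q"
    using deriv_relation_s[OF i] p by (intro subst_sq_embed) (auto simp: deriv_relation_def s_img_def)
  then have *: "skew_deriv (s_img i) {i, i + 1} (sq_embed p) = 0 \<longleftrightarrow> ?u * sq_embed p = sq_embed ?q * ?u"
    using skew_deriv_s_eq_0_iff[OF i sq_embed_closed[OF p]] by simp
  show ?thesis
  proof
    assume "?q = p"
    with * show "skew_deriv (s_img i) {i, i + 1} (sq_embed p) = 0" by (simp add: sq_embed_central)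
  next
    assume "skew_deriv (s_img i) {i, i + 1} (sq_embed p) = 0"
    with * have "sq_embed (?q - p) * ?u = 0"
      by (simp add: sq_embed_diff left_diff_distrib sq_embed_central[of p])
    then have "sq_embed (?q - p) * (?u * ?u) = 0" by (simp flip: mult.assoc)
    moreover have "?u * ?u = sq_embed (mpoly_var i + mpoly_var (i + 1))"
      using diff_square_anticommuting[OF xvar_anticommute[of "i + 1" i]]
      by (simp add: sq_embed_add sq_embed_var)
    ultimately have "sq_embed (mpoly_var i + mpoly_var (i + 1)) * sq_embed (?q - p) = 0"
      by (metis sq_embed_central)
    then have "sq_embed (?q - p) = 0"
      using mpoly_var_neq(2) by (rule sq_embed_mult_eq_0)
    then show "?q = p" using sq_embed_eq_iff[of "?q - p" 0] by simp
  qed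
qed

lemma skew_deriv_sB_sq_embed:
  assumes n: "n \<ge> 1" and p: "p \<in> mpoly_in n"
  shows "skew_deriv sB_img {n} (sq_embed p) = 0"
proof -
  have "subst sB_img (sq_embed p) = sq_embed (perm_act (\<lambda>j. j) p)"
    using deriv_relation_sB[of n] p by (intro subst_sq_embed) (auto simp: deriv_relation_def sB_img_def)
  moreover have "perm_act (\<lambda>j. j) p = p"
  proof -
    have "perm_exp (\<lambda>j. j) m = m" for m
      using word_exp_surj[of m] perm_exp_word_exp[of "\<lambda>j. j"] by auto
    note [simp] = this
    show ?thesis
      using subset_UNIV[of "Poly_Mapping.keys p"]
      by (induction rule: frag_induction) (simp_all add: perm_act_diff)
  qed
  ultimately show ?thesis
    using skew_deriv_sB_eq_0_iff[OF n sq_embed_closed[OF p]] by (simp add: sq_embed_central)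
qed

theorem skew_kernel:
  assumes n: "n \<ge> 1" and f: "f \<in> skew_pol n"
  shows "(\<forall>i\<in>{1..<n}. skew_deriv (s_img i) {i, i + 1} f = 0) \<and> skew_deriv sB_img {n} f = 0 \<longleftrightarrow>
    (\<exists>p\<in>mpoly_in n. f = sq_embed p \<and> (\<forall>i\<in>{1..<n}. perm_act (adj i) p = p))"
proof safe
  assume *: "\<forall>i\<in>{1..<n}. skew_deriv (s_img i) {i, i + 1} f = 0" "skew_deriv sB_img {n} f = 0"
  then obtain p where p: "p \<in> mpoly_in n" "f = sq_embed p"
    using even_eq_sq_embed[OF f] kernel_even[OF n f] by metis
  then show "\<exists>p\<in>mpoly_in n. f = sq_embed p \<and> (\<forall>i\<in>{1..<n}. perm_act (adj i) p = p)"
    using * skew_deriv_s_sq_embed by blast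
next
  fix p i assume p: "Poly_Mapping.keys p \<subseteq> exps_in n" "\<forall>i\<in>{1..<n}. perm_act (adj i) p = p"
  then show "skew_deriv sB_img {n} (sq_embed p) = 0" using skew_deriv_sB_sq_embed[OF n] by simp
  assume "i \<in> {1..<n}"
  with p show "skew_deriv (s_img i) {i, i + 1} (sq_embed p) = 0"
    using skew_deriv_s_sq_embed[of i n p] by simp
qed

section \<open>Elementary symmetric polynomials\<close>

definition set_exp :: "nat set \<Rightarrow> (nat \<Rightarrow>\<^sub>0 nat)" where
  "set_exp S = (\<Sum>i\<in>S. unit_exp i)"

definition elem_sym :: "nat \<Rightarrow> nat \<Rightarrow> mpoly" where
  "elem_sym n k = (\<Sum>S\<in>{S. S \<subseteq> {1..n} \<and> card S = k}. frag_of (set_exp S))"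

definition elem_monom :: "nat \<Rightarrow> (nat \<Rightarrow>\<^sub>0 nat) \<Rightarrow> mpoly" where
  "elem_monom n m = (\<Prod>k\<in>{1..n}. elem_sym n k ^ Poly_Mapping.lookup m k)"

text \<open>The homomorphism that sends the \<open>k\<close>-th variable to the \<open>k\<close>-th elementary symmetric polynomial, for
\<open>1 \<le> k \<le> n\<close>.\<close>

definition elem_hom :: "nat \<Rightarrow> mpoly \<Rightarrow> mpoly" where
  "elem_hom n = lin (elem_monom n)"

lemma elem_hom_mult: "elem_hom n (p * q) = elem_hom n p * elem_hom n q"
  unfolding elem_hom_def
  by (rule lin_mult) (simp add: elem_monom_def lookup_add power_add prod.distrib)

lemma elem_hom_add: "elem_hom n (p + q) = elem_hom n p + elem_hom n q"
  and elem_hom_diff: "elem_hom n (p - q) = elem_hom n p - elem_hom n q"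
  and elem_hom_zero [simp]: "elem_hom n 0 = 0"
  and elem_hom_one [simp]: "elem_hom n 1 = 1"
  and elem_hom_single: "elem_hom n (Poly_Mapping.single m c) = of_int c * elem_monom n m"
  by (simp_all add: elem_hom_def lin_add lin_diff elem_monom_def)

lemma elem_hom_var:
  assumes "k \<in> {1..n}"
  shows "elem_hom n (mpoly_var k) = elem_sym n k"
proof -
  have "elem_monom n (unit_exp k) = (\<Prod>j\<in>{1..n}. if j = k then elem_sym n j else 1)"
    unfolding elem_monom_def by (rule prod.cong) (auto simp: lookup_single)
  also have "\<dots> = elem_sym n k" using assms by (simp add: prod.delta)
  finally show ?thesis by (simp add: mpoly_var_def elem_hom_single)
qed

lemma mpoly_in_mult:
  assumes "p \<in> mpoly_in n" "q \<in> mpoly_in n"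
  shows "p * q \<in> mpoly_in n"
  using assms Poly_Mapping.keys_mult[of p q] exps_in_add by fastforce

lemma mpoly_in_diff: "p \<in> mpoly_in n \<Longrightarrow> q \<in> mpoly_in n \<Longrightarrow> p - q \<in> mpoly_in n"
  and mpoly_in_add: "p \<in> mpoly_in n \<Longrightarrow> q \<in> mpoly_in n \<Longrightarrow> p + q \<in> mpoly_in n"
  using keys_diff[of p q] Poly_Mapping.keys_add[of p q] by auto

lemma mpoly_in_of_int_mult: "p \<in> mpoly_in n \<Longrightarrow> of_int c * p \<in> mpoly_in n"
  by (rule mpoly_in_mult) (simp_all flip: single_of_int)

lemma mpoly_in_power: "p \<in> mpoly_in n \<Longrightarrow> p ^ k \<in> mpoly_in n"
  by (induction k) (simp_all, simp add: mpoly_in_mult[simplified])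

lemma lookup_set_exp: "finite S \<Longrightarrow> Poly_Mapping.lookup (set_exp S) j = of_bool (j \<in> S)"
  by (simp add: set_exp_def lookup_sum lookup_single when_def)

lemma set_exp_in: "S \<subseteq> {1..n} \<Longrightarrow> set_exp S \<in> exps_in n"
  using finite_subset[of S "{1..n}"] by (auto simp: exps_in_def in_keys_iff lookup_set_exp)

lemma mpoly_in_sum: "(\<And>i. i \<in> I \<Longrightarrow> f i \<in> mpoly_in n) \<Longrightarrow> sum f I \<in> mpoly_in n"
  using keys_sum[of f I] by fastforce

lemma mpoly_in_prod:
  assumes "\<And>i. i \<in> I \<Longrightarrow> f i \<in> mpoly_in n"
  shows "prod f I \<in> mpoly_in n"
  using assms
proof (induction I rule: infinite_finite_induct)
  case (insert i I)
  then show ?case using mpoly_in_mult[of "f i" n "prod f I"] by simp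
qed simp_all

lemma elem_in: "elem_sym n k \<in> mpoly_in n"
  unfolding elem_sym_def by (rule mpoly_in_sum) (auto simp: set_exp_in)

lemma elem_monom_in: "elem_monom n m \<in> mpoly_in n"
  unfolding elem_monom_def by (intro mpoly_in_prod mpoly_in_power elem_in)

lemma elem_hom_in: "elem_hom n q \<in> mpoly_in n"
  using subset_UNIV[of "Poly_Mapping.keys q"]
  by (induction rule: frag_induction)
     (simp_all add: elem_hom_single elem_hom_diff elem_monom_in[simplified] mpoly_in_diff[simplified])

lemma perm_act_mult: "perm_act \<pi> (p * q) = perm_act \<pi> p * perm_act \<pi> q"
  unfolding perm_act_def by (rule lin_mult) (simp add: perm_exp_add mult_single)

lemma perm_act_add: "perm_act \<pi> (p + q) = perm_act \<pi> p + perm_act \<pi> q"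
  and perm_act_one [simp]: "perm_act \<pi> 1 = 1"
  by (simp_all add: perm_act_def lin_add)

lemma perm_act_sum: "perm_act \<pi> (sum f I) = (\<Sum>i\<in>I. perm_act \<pi> (f i))"
  by (induction I rule: infinite_finite_induct) (simp_all add: perm_act_add)

lemma perm_act_prod: "perm_act \<pi> (prod f I) = (\<Prod>i\<in>I. perm_act \<pi> (f i))"
  by (induction I rule: infinite_finite_induct) (simp_all add: perm_act_mult)

lemma perm_act_power: "perm_act \<pi> (p ^ k) = perm_act \<pi> p ^ k"
  by (induction k) (simp_all add: perm_act_mult)

lemma perm_act_of_int: "perm_act \<pi> (of_int c * p) = of_int c * perm_act \<pi> p"
proof -
  have "perm_act \<pi> (of_int c) = of_int c"
    by (simp add: perm_act_def flip: single_of_int)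
  then show ?thesis by (simp add: perm_act_mult)
qed

lemma perm_exp_single: "perm_exp \<pi> (Poly_Mapping.single i c) = Poly_Mapping.single (\<pi> i) c"
  by (simp add: perm_exp_def)

lemma perm_exp_set_exp:
  assumes "inj \<pi>" "finite S"
  shows "perm_exp \<pi> (set_exp S) = set_exp (\<pi> ` S)"
proof -
  have "perm_exp \<pi> (set_exp S) = (\<Sum>i\<in>S. unit_exp (\<pi> i))"
    unfolding set_exp_def using assms(2)
    by (induction S rule: finite_induct) (simp_all add: perm_exp_add perm_exp_single)
  also have "\<dots> = set_exp (\<pi> ` S)"
    unfolding set_exp_def using assms(1) by (subst sum.reindex) (auto simp: inj_on_def)
  finally show ?thesis .
qed

lemma perm_act_elem:
  assumes \<pi>: "\<pi> permutes {1..n}"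
  shows "perm_act \<pi> (elem_sym n k) = elem_sym n k"
proof -
  have inj: "inj \<pi>" using \<pi> by (rule permutes_inj)
  let ?\<rho> = "inv_into UNIV \<pi>"
  have \<pi>': "?\<rho> permutes {1..n}" using \<pi> by (rule permutes_inv)
  have "perm_act \<pi> (elem_sym n k) = (\<Sum>S | S \<subseteq> {1..n} \<and> card S = k. frag_of (set_exp (\<pi> ` S)))"
    unfolding elem_sym_def perm_act_sum
    by (rule sum.cong) (auto simp: perm_exp_set_exp[OF inj] finite_subset[of _ "{1..n}"])
  also have "\<dots> = elem_sym n k"
    unfolding elem_sym_def
  proof (rule sum.reindex_bij_witness[of _ "\<lambda>S. ?\<rho> ` S" "\<lambda>S. \<pi> ` S"])
    fix S assume S: "S \<in> {S. S \<subseteq> {1..n} \<and> card S = k}"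
    show "?\<rho> ` \<pi> ` S = S" using inj by (simp add: image_image)
    show "\<pi> ` ?\<rho> ` S = S" using permutes_inverses(1)[OF \<pi>] by (simp add: image_image)
    show "\<pi> ` S \<in> {S. S \<subseteq> {1..n} \<and> card S = k}"
      using S permutes_image[OF \<pi>] inj by (auto simp: card_image inj_on_subset permutes_in_image[OF \<pi>])
    show "?\<rho> ` S \<in> {S. S \<subseteq> {1..n} \<and> card S = k}"
      using S permutes_inj[OF \<pi>'] permutes_in_image[OF \<pi>'] by (auto simp: card_image inj_on_subset)
  qed simp
  finally show ?thesis .
qed

lemma perm_act_elem_monom: "\<pi> permutes {1..n} \<Longrightarrow> perm_act \<pi> (elem_monom n m) = elem_monom n m"
  unfolding elem_monom_def by (simp add: perm_act_prod perm_act_power perm_act_elem del: atLeastAtMost_iff)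

lemma perm_act_elem_hom:
  assumes "\<pi> permutes {1..n}"
  shows "perm_act \<pi> (elem_hom n q) = elem_hom n q"
  using subset_UNIV[of "Poly_Mapping.keys q"]
  by (induction rule: frag_induction)
     (simp_all add: elem_hom_single elem_hom_diff perm_act_diff perm_act_elem_monom[OF assms])

text \<open>A polynomial is led by \<open>a\<close> if it is monic with leading exponent \<open>a\<close> in the lexicographic order, in
which smaller indices weigh more.\<close>

definition leads :: "mpoly \<Rightarrow> (nat \<Rightarrow>\<^sub>0 nat) \<Rightarrow> bool" where
  "leads p a \<longleftrightarrow> (\<exists>r. p = frag_of a + r \<and> (\<forall>b\<in>Poly_Mapping.keys r. b < a))"

lemma leads_lookup:
  assumes "leads p a"
  shows "Poly_Mapping.lookup p a = 1" and "a < b \<Longrightarrow> Poly_Mapping.lookup p b = 0"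
    and "b \<in> Poly_Mapping.keys p \<Longrightarrow> b \<le> a"
proof -
  obtain r where r: "p = frag_of a + r" "\<forall>b\<in>Poly_Mapping.keys r. b < a"
    using assms by (auto simp: leads_def)
  then have "a \<notin> Poly_Mapping.keys r" by blast
  with r(1) show "Poly_Mapping.lookup p a = 1" by (simp add: lookup_add in_keys_iff)
  show *: "Poly_Mapping.lookup p b = 0" if "a < b" for b
  proof -
    have "b \<notin> Poly_Mapping.keys r" using r(2) that by (meson not_less_iff_gr_or_eq)
    with r(1) that show ?thesis by (auto simp: lookup_add in_keys_iff)
  qed
  show "b \<in> Poly_Mapping.keys p \<Longrightarrow> b \<le> a"
    using *[of b] by (metis in_keys_iff not_less)
qed

lemma leads_one: "leads 1 0"
  by (auto simp: leads_def intro!: exI[of _ 0])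

lemma leads_mult:
  assumes "leads p a" "leads q b"
  shows "leads (p * q) (a + b)"
proof -
  obtain r where r: "p = frag_of a + r" "\<forall>c\<in>Poly_Mapping.keys r. c < a"
    using assms(1) by (auto simp: leads_def)
  obtain s where s: "q = frag_of b + s" "\<forall>c\<in>Poly_Mapping.keys s. c < b"
    using assms(2) by (auto simp: leads_def)
  have "p * q = frag_of (a + b) + (frag_of a * s + r * q)"
    by (simp add: r(1) s(1) algebra_simps mult_single)
  moreover have "c < a + b" if "c \<in> Poly_Mapping.keys (frag_of a * s + r * q)" for c
  proof -
    from that consider "c \<in> Poly_Mapping.keys (frag_of a * s)" | "c \<in> Poly_Mapping.keys (r * q)"
      using Poly_Mapping.keys_add[of "frag_of a * s" "r * q"] by blast
    then show ?thesis
    proof cases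
      case 1
      then obtain d where "d \<in> Poly_Mapping.keys s" "c = a + d"
        using Poly_Mapping.keys_mult[of "frag_of a" s] by auto
      with s(2) show ?thesis by (simp add: add_strict_left_mono)
    next
      case 2
      then obtain d e where "d \<in> Poly_Mapping.keys r" "e \<in> Poly_Mapping.keys q" "c = d + e"
        using Poly_Mapping.keys_mult[of r q] by auto
      with r(2) leads_lookup(3)[OF assms(2)] show ?thesis by (simp add: add_less_le_mono)
    qed
  qed
  ultimately show ?thesis unfolding leads_def by blast
qed

lemma less_exp_iff:
  "a < b \<longleftrightarrow> (\<exists>k. Poly_Mapping.lookup a k < Poly_Mapping.lookup b k \<and>
     (\<forall>j<k. Poly_Mapping.lookup a j = Poly_Mapping.lookup b j))"
  by (simp add: less_poly_mapping.rep_eq less_fun_def)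

lemma leads_elem:
  assumes k: "k \<in> {1..n}"
  shows "leads (elem_sym n k) (set_exp {1..k})"
proof -
  let ?F = "{S. S \<subseteq> {1..n} \<and> card S = k}"
  define g :: "nat set \<Rightarrow> mpoly" where "g S = frag_of (set_exp S)" for S
  let ?r = "sum g (?F - {{1..k}})"
  have fin: "finite ?F" by (rule finite_subset[of _ "Pow {1..n}"]) auto
  have mem: "{1..k} \<in> ?F" using k by auto
  have "elem_sym n k = sum g ?F" by (simp add: elem_sym_def g_def)
  also have "\<dots> = frag_of (set_exp {1..k}) + ?r"
    using sum.remove[OF fin mem, of g] by (simp add: g_def)
  finally have "elem_sym n k = frag_of (set_exp {1..k}) + ?r" .
  moreover have "b < set_exp {1..k}" if "b \<in> Poly_Mapping.keys ?r" for b
  proof -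
    from that have "b \<in> (\<Union>S\<in>?F - {{1..k}}. Poly_Mapping.keys (g S))"
      using keys_sum[of g "?F - {{1..k}}"] by (rule rev_subsetD)
    then obtain S where "S \<in> ?F - {{1..k}}" "b = set_exp S" by (auto simp: g_def)
    then have S: "S \<subseteq> {1..n}" "card S = k" "S \<noteq> {1..k}" "b = set_exp S" by blast+
    have fin: "finite S" using S(1) finite_subset by blast
    have "\<not> {1..k} \<subseteq> S"
      using S(2,3) fin card_subset_eq[of S "{1..k}"] by auto
    then have ex: "\<exists>i. i \<in> {1..k} - S" by blast
    \<comment> \<open>The first index that \<open>S\<close> misses decides the comparison.\<close>
    define i where "i = (LEAST i. i \<in> {1..k} - S)"
    have i: "i \<in> {1..k} - S" unfolding i_def using ex by (rule LeastI_ex)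
    have least: "j \<notin> {1..k} - S" if "j < i" for j
      using that not_less_Least unfolding i_def by blast
    have "j \<in> S \<longleftrightarrow> j \<in> {1..k}" if "j < i" for j
      using least[OF that] that i S(1) by auto
    then show ?thesis
      unfolding less_exp_iff S(4) using i fin by (intro exI[of _ i]) (simp add: lookup_set_exp)
  qed
  ultimately show ?thesis unfolding leads_def by blast
qed

text \<open>The leading exponent of \<open>e\<^sub>1\<^sup>m\<^sup>1 \<dots> e\<^sub>n\<^sup>m\<^sup>n\<close>.  Its \<open>i\<close>-th entry is \<open>m\<^sub>i + \<dots> + m\<^sub>n\<close>, so \<open>m\<close> can be
recovered from it by differences, and the exponents that occur are the decreasing ones.\<close>

definition lead_exp :: "nat \<Rightarrow> (nat \<Rightarrow>\<^sub>0 nat) \<Rightarrow> (nat \<Rightarrow>\<^sub>0 nat)" where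
  "lead_exp n m = (\<Sum>k\<in>{1..n}. \<Sum>i\<in>{1..k}. Poly_Mapping.single i (Poly_Mapping.lookup m k))"

lemma leads_elem_monom: "leads (elem_monom n m) (lead_exp n m)"
proof -
  have power: "leads (elem_sym n k ^ c) (\<Sum>i\<in>{1..k}. Poly_Mapping.single i c)" if "k \<in> {1..n}" for k c
  proof (induction c)
    case (Suc c)
    have "(\<Sum>i\<in>{1..k}. Poly_Mapping.single i (Suc c)) = set_exp {1..k} + (\<Sum>i\<in>{1..k}. Poly_Mapping.single i c)"
      by (simp add: set_exp_def flip: sum.distrib single_add)
    with leads_mult[OF leads_elem[OF that] Suc] show ?case by simp
  qed (simp add: leads_one)
  have "leads (\<Prod>k\<in>A. elem_sym n k ^ Poly_Mapping.lookup m k)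
      (\<Sum>k\<in>A. \<Sum>i\<in>{1..k}. Poly_Mapping.single i (Poly_Mapping.lookup m k))" if "finite A" "A \<subseteq> {1..n}" for A
    using that
  proof (induction A rule: finite_induct)
    case (insert k A)
    then show ?case using leads_mult[OF power] by simp
  qed (simp add: leads_one)
  then show ?thesis by (simp add: elem_monom_def lead_exp_def)
qed

lemma lookup_lead_exp:
  "Poly_Mapping.lookup (lead_exp n m) i = (\<Sum>k\<in>{1..n}. if i \<in> {1..k} then Poly_Mapping.lookup m k else 0)"
  by (simp add: lead_exp_def lookup_sum lookup_single when_def sum.delta')

lemma lookup_lead_exp_Suc:
  assumes "i \<in> {1..n}"
  shows "Poly_Mapping.lookup (lead_exp n m) i = Poly_Mapping.lookup m i + Poly_Mapping.lookup (lead_exp n m) (Suc i)"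
proof -
  have "Poly_Mapping.lookup (lead_exp n m) i =
    (\<Sum>k\<in>{1..n}. (if k = i then Poly_Mapping.lookup m k else 0) + (if Suc i \<in> {1..k} then Poly_Mapping.lookup m k else 0))"
    unfolding lookup_lead_exp using assms by (intro sum.cong) auto
  also have "\<dots> = Poly_Mapping.lookup m i + Poly_Mapping.lookup (lead_exp n m) (Suc i)"
    unfolding lookup_lead_exp sum.distrib using assms by (simp add: sum.delta)
  finally show ?thesis .
qed

lemma lookup_lead_exp_outside: "i \<notin> {1..n} \<Longrightarrow> Poly_Mapping.lookup (lead_exp n m) i = 0"
  by (auto simp: lookup_lead_exp)

lemma lookup_exps_in: "m \<in> exps_in n \<Longrightarrow> i \<notin> {1..n} \<Longrightarrow> Poly_Mapping.lookup m i = 0"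
  by (auto simp: exps_in_def in_keys_iff subset_iff)

lemma lead_exp_inj:
  assumes "m \<in> exps_in n" "m' \<in> exps_in n" "lead_exp n m = lead_exp n m'"
  shows "m = m'"
proof (rule poly_mapping_eqI)
  fix i show "Poly_Mapping.lookup m i = Poly_Mapping.lookup m' i"
  proof (cases "i \<in> {1..n}")
    case True
    then show ?thesis using assms(3) lookup_lead_exp_Suc[OF True, of m] lookup_lead_exp_Suc[OF True, of m'] by simp
  next
    case False
    show ?thesis
      unfolding lookup_exps_in[OF assms(1) False] lookup_exps_in[OF assms(2) False] ..
  qed
qed

lemma lead_exp_surj:
  assumes a: "a \<in> exps_in n"
    and dec: "\<And>i. i \<in> {1..<n} \<Longrightarrow> Poly_Mapping.lookup a (i + 1) \<le> Poly_Mapping.lookup a i"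
  obtains m where "m \<in> exps_in n" "lead_exp n m = a"
proof
  define m where "m = (\<Sum>i\<in>{1..n}. Poly_Mapping.single i (Poly_Mapping.lookup a i - Poly_Mapping.lookup a (i + 1)))"
  have m: "Poly_Mapping.lookup m i = (if i \<in> {1..n} then Poly_Mapping.lookup a i - Poly_Mapping.lookup a (i + 1) else 0)" for i
    by (simp add: m_def lookup_sum lookup_single when_def sum.delta')
  show "m \<in> exps_in n" by (auto simp: exps_in_def in_keys_iff m split: if_splits)
  have dec': "Poly_Mapping.lookup a (Suc i) \<le> Poly_Mapping.lookup a i" if "i \<in> {1..n}" for i
    using dec[of i] that lookup_exps_in[OF a, of "Suc i"] by (cases "i = n") auto
  show "lead_exp n m = a"
  proof (rule poly_mapping_eqI)
    fix i show "Poly_Mapping.lookup (lead_exp n m) i = Poly_Mapping.lookup a i"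
    proof (cases "i \<in> {1..n}")
      case True
      then have "i \<le> Suc n" "1 \<le> i" by auto
      then show ?thesis
      proof (induction i rule: inc_induct)
        case base
        show ?case using lookup_lead_exp_outside[of "Suc n" n m] lookup_exps_in[OF a, of "Suc n"] by simp
      next
        case (step i)
        then have i: "i \<in> {1..n}" by auto
        show ?case using lookup_lead_exp_Suc[OF i, of m] step m[of i] dec'[OF i] i by simp
      qed
    next
      case False
      show ?thesis
        unfolding lookup_exps_in[OF a False] lookup_lead_exp_outside[OF False] ..
    qed
  qed
qed

lemma lookup_of_int_mult: "Poly_Mapping.lookup (of_int c * p) a = c * Poly_Mapping.lookup p (a :: nat \<Rightarrow>\<^sub>0 nat)"
proof (induction c rule: int_induct[of _ 0])
  case (step1 i) then show ?case by (simp add: algebra_simps lookup_add)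
next
  case (step2 i) then show ?case by (simp add: algebra_simps lookup_minus)
qed simp

text \<open>Algebraic independence: distinct monomials in the \<open>e\<^sub>k\<close> have distinct leading exponents, so the
largest of them cannot cancel.\<close>

lemma elem_hom_eq_0:
  assumes p: "p \<in> mpoly_in n" and 0: "elem_hom n p = 0"
  shows "p = 0"
proof (rule ccontr)
  assume "p \<noteq> 0"
  then have "Poly_Mapping.keys p \<noteq> {}" by simp
  then have "Max (lead_exp n ` Poly_Mapping.keys p) \<in> lead_exp n ` Poly_Mapping.keys p" by (intro Max_in) auto
  then obtain m where m: "m \<in> Poly_Mapping.keys p" "lead_exp n m = Max (lead_exp n ` Poly_Mapping.keys p)" by auto
  let ?c = "\<lambda>k. Poly_Mapping.lookup p k * Poly_Mapping.lookup (elem_monom n k) (lead_exp n m)"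
  have "?c k = 0" if "k \<in> Poly_Mapping.keys p - {m}" for k
  proof -
    have "lead_exp n k \<le> lead_exp n m" using that m(2) by simp
    moreover have "lead_exp n k \<noteq> lead_exp n m" using that m(1) p lead_exp_inj by blast
    ultimately show ?thesis using leads_lookup(2)[OF leads_elem_monom] by simp
  qed
  then have "sum ?c (Poly_Mapping.keys p - {m}) = 0"
    by (intro sum.neutral) blast
  then have "sum ?c (Poly_Mapping.keys p) = ?c m"
    using sum.remove[OF finite_keys m(1), of ?c] by simp
  moreover have "Poly_Mapping.lookup (elem_hom n p) (lead_exp n m) = sum ?c (Poly_Mapping.keys p)"
    by (simp add: elem_hom_def lin_def lookup_sum lookup_of_int_mult)
  ultimately have "Poly_Mapping.lookup p m = 0"
    using leads_lookup(1)[OF leads_elem_monom, of n m] 0 by simp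
  with m(1) show False by (simp add: in_keys_iff)
qed

text \<open>With boundedly many variables, exponents compare like lists of fixed length, for which the
lexicographic order is well-founded.\<close>

lemma wf_exps_in: "wf {(a, b). a \<in> exps_in n \<and> b \<in> exps_in n \<and> a < b}"
proof (rule wf_subset)
  let ?f = "\<lambda>a. map (Poly_Mapping.lookup a) [0..<Suc n]"
  show "wf (inv_image (lexn less_than (Suc n)) ?f)"
    by (intro wf_inv_image wf_lexn wf_less_than)
  show "{(a, b). a \<in> exps_in n \<and> b \<in> exps_in n \<and> a < b} \<subseteq> inv_image (lexn less_than (Suc n)) ?f"
  proof clarify
    fix a b :: "nat \<Rightarrow>\<^sub>0 nat" assume ab: "a \<in> exps_in n" "b \<in> exps_in n" "a < b"
    then obtain k where k: "Poly_Mapping.lookup a k < Poly_Mapping.lookup b k"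
      "\<And>j. j < k \<Longrightarrow> Poly_Mapping.lookup a j = Poly_Mapping.lookup b j"
      by (auto simp: less_exp_iff)
    then have "k \<in> {1..n}" using lookup_exps_in[OF ab(2), of k] by auto
    then have "k < Suc n" by auto
    then have split: "[0..<Suc n] = [0..<k] @ k # [Suc k..<Suc n]"
      using upt_add_eq_append[of 0 k "Suc n - k"] upt_conv_Cons[of k "Suc n"] by simp
    have "?f a = map (Poly_Mapping.lookup b) [0..<k] @ Poly_Mapping.lookup a k # map (Poly_Mapping.lookup a) [Suc k..<Suc n]"
      unfolding split using k(2) by simp
    moreover have "?f b = map (Poly_Mapping.lookup b) [0..<k] @ Poly_Mapping.lookup b k # map (Poly_Mapping.lookup b) [Suc k..<Suc n]"
      unfolding split by simp
    ultimately show "(a, b) \<in> inv_image (lexn less_than (Suc n)) ?f"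
      using k(1) \<open>k < Suc n\<close> unfolding in_inv_image lexn_conv by (auto simp del: upt_Suc)
  qed
qed

lemma lookup_perm_act:
  assumes "inj \<pi>"
  shows "Poly_Mapping.lookup (perm_act \<pi> p) (perm_exp \<pi> m) = Poly_Mapping.lookup p m"
proof -
  have "perm_exp \<pi> a = perm_exp \<pi> b \<longleftrightarrow> a = b" for a b
    using lookup_perm_exp[OF assms] by (metis poly_mapping_eqI)
  note [simp] = this
  show ?thesis
    using subset_UNIV[of "Poly_Mapping.keys p"]
    by (induction rule: frag_induction) (simp_all add: perm_act_diff lookup_minus lookup_single when_def)
qed

text \<open>If the leading exponent increased from \<open>i\<close> to \<open>i + 1\<close>, exchanging the two entries would give a
larger exponent that occurs as well.\<close>

lemma symmetric_lead_decreasing: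
  assumes p: "p \<noteq> 0" and sym: "perm_act (adj i) p = p"
  shows "Poly_Mapping.lookup (Max (Poly_Mapping.keys p)) (i + 1) \<le> Poly_Mapping.lookup (Max (Poly_Mapping.keys p)) i"
proof (rule ccontr)
  let ?a = "Max (Poly_Mapping.keys p)"
  let ?b = "perm_exp (adj i) ?a"
  assume "\<not> ?thesis"
  then have less: "Poly_Mapping.lookup ?a i < Poly_Mapping.lookup ?a (i + 1)" by simp
  have inj: "inj (adj i)" by (rule inj_transpose)
  have "?a \<in> Poly_Mapping.keys p" using p by (intro Max_in) auto
  then have "?b \<in> Poly_Mapping.keys p"
    using lookup_perm_act[OF inj, of p ?a] sym by (simp add: in_keys_iff)
  then have "?b \<le> ?a" by simp
  moreover have "?a < ?b"
    unfolding less_exp_iff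
  proof (intro exI[of _ i] conjI allI impI)
    show "Poly_Mapping.lookup ?a i < Poly_Mapping.lookup ?b i"
      using lookup_perm_exp[OF inj, of ?a "i + 1"] less by simp
    fix j assume "j < i"
    then show "Poly_Mapping.lookup ?a j = Poly_Mapping.lookup ?b j"
      using lookup_perm_exp[OF inj, of ?a j] by simp
  qed
  ultimately show False by simp
qed

text \<open>The classical reduction: the leading term of a symmetric polynomial is the leading term of a
monomial in the \<open>e\<^sub>k\<close>, and subtracting the latter leaves a symmetric polynomial with a smaller
leading exponent.  Only adjacent transpositions enter, since these suffice to make the leading
exponent decreasing.\<close>

theorem symmetric_imp_elem_hom:
  assumes "p \<in> mpoly_in n" and "\<And>i. i \<in> {1..<n} \<Longrightarrow> perm_act (adj i) p = p"
  shows "\<exists>q\<in>mpoly_in n. p = elem_hom n q"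
proof (cases "p = 0")
  case True
  then show ?thesis by (intro bexI[of _ 0]) auto
next
  case False
  then show ?thesis using assms
  proof (induction "Max (Poly_Mapping.keys p)" arbitrary: p rule: wf_induct_rule[OF wf_exps_in[of n]])
    case (1 p)
    let ?a = "Max (Poly_Mapping.keys p)"
    let ?c = "Poly_Mapping.lookup p ?a"
    have a: "?a \<in> Poly_Mapping.keys p" using 1(2) by (intro Max_in) auto
    then have a_in: "?a \<in> exps_in n" using 1(3) by auto
    obtain m where m: "m \<in> exps_in n" "lead_exp n m = ?a"
      using lead_exp_surj[OF a_in] symmetric_lead_decreasing[OF 1(2) 1(4)] by metis
    define r where "r = p - of_int ?c * elem_monom n m"
    have r_in: "r \<in> mpoly_in n"
      unfolding r_def using 1(3) by (intro mpoly_in_diff mpoly_in_of_int_mult elem_monom_in)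
    have "\<exists>q\<in>mpoly_in n. r = elem_hom n q"
    proof (cases "r = 0")
      case True
      then show ?thesis by (intro bexI[of _ 0]) auto
    next
      case False
      then have b: "Max (Poly_Mapping.keys r) \<in> Poly_Mapping.keys r" (is "?b \<in> _") by (intro Max_in) auto
      have "Poly_Mapping.lookup r ?a = 0"
        using leads_lookup(1)[OF leads_elem_monom, of n m] m(2) by (simp add: r_def lookup_minus lookup_of_int_mult)
      then have "?b \<noteq> ?a" using b by (metis in_keys_iff)
      moreover have "?b \<le> ?a"
      proof (rule ccontr)
        assume "\<not> ?b \<le> ?a"
        then have less: "?a < ?b" by simp
        then have "?b \<notin> Poly_Mapping.keys p" using Max_ge[OF finite_keys, of ?b p] by (metis leD)
        moreover have "Poly_Mapping.lookup (elem_monom n m) ?b = 0"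
          using leads_lookup(2)[OF leads_elem_monom, of n m] m(2) less by simp
        ultimately show False
          using b by (simp add: r_def in_keys_iff lookup_minus lookup_of_int_mult)
      qed
      ultimately have "?b < ?a" by simp
      moreover have "?b \<in> exps_in n" using b r_in by auto
      moreover have "perm_act (adj i) r = r" if "i \<in> {1..<n}" for i
      proof -
        have "adj i permutes {1..n}" using that by (intro permutes_swap_id) auto
        then show ?thesis
          using 1(4)[OF that] by (simp add: r_def perm_act_diff perm_act_of_int perm_act_elem_monom)
      qed
      ultimately show ?thesis using 1(1)[of r] False r_in a_in by simp
    qed
    then obtain q where q: "q \<in> mpoly_in n" "r = elem_hom n q" by blast
    have "p = elem_hom n (q + Poly_Mapping.single m ?c)"
      using q(2) by (simp add: elem_hom_add elem_hom_single r_def algebra_simps)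
    moreover have "q + Poly_Mapping.single m ?c \<in> mpoly_in n"
      using q(1) m(1) by (intro mpoly_in_add) auto
    ultimately show ?case by blast
  qed
qed

section \<open>The ring of spin type B symmetric polynomials\<close>

lemma mpoly_hom_unique:
  fixes \<psi> :: "mpoly \<Rightarrow> 'a::ring_1"
  assumes p: "p \<in> mpoly_in n"
    and add: "\<And>p q. p \<in> mpoly_in n \<Longrightarrow> q \<in> mpoly_in n \<Longrightarrow> \<psi> (p + q) = \<psi> p + \<psi> q"
    and mult: "\<And>p q. p \<in> mpoly_in n \<Longrightarrow> q \<in> mpoly_in n \<Longrightarrow> \<psi> (p * q) = \<psi> p * \<psi> q"
    and one: "\<psi> 1 = 1"
    and add': "\<And>p q. p \<in> mpoly_in n \<Longrightarrow> q \<in> mpoly_in n \<Longrightarrow> \<psi>' (p + q) = \<psi>' p + \<psi>' q"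
    and mult': "\<And>p q. p \<in> mpoly_in n \<Longrightarrow> q \<in> mpoly_in n \<Longrightarrow> \<psi>' (p * q) = \<psi>' p * \<psi>' q"
    and one': "\<psi>' 1 = 1"
    and var: "\<And>i. i \<in> {1..n} \<Longrightarrow> \<psi> (mpoly_var i) = \<psi>' (mpoly_var i)"
  shows "\<psi> p = \<psi>' p"
proof -
  from p have "Poly_Mapping.keys p \<subseteq> exps_in n" by simp
  then have "p \<in> mpoly_in n \<and> \<psi> p = \<psi>' p"
  proof (induction rule: frag_induction)
    case zero
    show ?case using add[of 0 0] add'[of 0 0] by simp
  next
    case (one m)
    obtain w where w: "m = word_exp w" using word_exp_surj by metis
    with one have "w \<in> lists {1..n}" by (simp add: exps_in_word_exp)
    then have "frag_of (word_exp w) \<in> mpoly_in n \<and> \<psi> (frag_of (word_exp w)) = \<psi>' (frag_of (word_exp w))"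
    proof (induction w)
      case Nil
      show ?case by (simp add: assms(4,7))
    next
      case (Cons i w)
      have "frag_of (word_exp (i # w)) = mpoly_var i * frag_of (word_exp w)"
        by (simp add: mpoly_var_def mult_single)
      moreover have "mpoly_var i \<in> mpoly_in n"
        using Cons.hyps(1) by (simp add: mpoly_var_def exps_in_single)
      ultimately show ?case
        using Cons mult mult' var mpoly_in_mult by metis
    qed
    then show ?case by (simp add: w)
  next
    case (diff p q)
    then have "p - q \<in> mpoly_in n" by (intro mpoly_in_diff) (rule conjunct1, assumption)+
    then show ?case
      using add[of "p - q" q] add'[of "p - q" q] diff by simp
  qed
  then show ?thesis ..
qed

lemma from_skew_minus:
  assumes "f \<in> skew_pol n"
  shows "from_skew n (- f) = \<ominus>\<^bsub>odd_pol n\<^esub> from_skew n f"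
proof -
  interpret ring "odd_pol n" by (rule ring_odd_pol)
  show ?thesis
    using assms
    by (intro to_skew_eqD[of _ n])
       (simp_all add: from_skew_closed skew_pol_minus to_skew_a_inv to_skew_from_skew)
qed

lemma sq_var_closed: "i \<in> {1..n} \<Longrightarrow> sq_var n i \<in> carrier (odd_pol n)"
proof -
  interpret ring "odd_pol n" by (rule ring_odd_pol)
  show "i \<in> {1..n} \<Longrightarrow> sq_var n i \<in> carrier (odd_pol n)"
    unfolding sq_var_def by (intro nat_pow_closed odd_var_closed)
qed

lemma to_skew_sq_var:
  assumes "i \<in> {1..n}"
  shows "to_skew (sq_var n i) = sq_embed (mpoly_var i)"
proof -
  interpret ring "odd_pol n" by (rule ring_odd_pol)
  show ?thesis
    using odd_var_closed[OF assms] to_skew_odd_var[OF assms]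
    by (simp add: sq_var_def numeral_2_eq_2 to_skew_hom sq_embed_var)
qed

lemma sq_var_eq_from_skew: "i \<in> {1..n} \<Longrightarrow> sq_var n i = from_skew n (sq_embed (mpoly_var i))"
  by (metis from_skew_to_skew sq_var_closed to_skew_sq_var)

lemma mpoly_var_in: "i \<in> {1..n} \<Longrightarrow> mpoly_var i \<in> mpoly_in n"
  by (simp add: mpoly_var_def exps_in_single)

lemma mpoly_in_one: "1 \<in> mpoly_in n"
  by simp

lemma mpoly_in_minus: "p \<in> mpoly_in n \<Longrightarrow> - p \<in> mpoly_in n"
  by simp

lemma sq_embed_minus: "sq_embed (- p) = - sq_embed p"
  using sq_embed_diff[of 0 p] by simp

abbreviation from_sq :: "nat \<Rightarrow> mpoly \<Rightarrow> (nat list \<Rightarrow>\<^sub>0 int) set" where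
  "from_sq n p \<equiv> from_skew n (sq_embed p)"

lemma carrier_sq_subalg:
  "carrier (sq_subalg n) = (\<lambda>p. from_skew n (sq_embed p)) ` mpoly_in n"
proof -
  interpret ring "odd_pol n" by (rule ring_odd_pol)
  let ?G = "generate_ring (odd_pol n) (sq_var n ` {1..n})"
  have "f \<in> (\<lambda>p. from_skew n (sq_embed p)) ` mpoly_in n" if "f \<in> ?G" for f
    using that
  proof induction
    case one
    show ?case by (rule image_eqI[OF _ mpoly_in_one]) (simp add: from_skew_hom)
  next
    case (incl h)
    then obtain i where "i \<in> {1..n}" "h = sq_var n i" by blast
    then show ?case by (intro image_eqI[of _ _ "mpoly_var i"] mpoly_var_in) (auto simp: sq_var_eq_from_skew)
  next
    case (a_inv h)
    then obtain p where p: "p \<in> mpoly_in n" "h = from_skew n (sq_embed p)" by blast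
    show ?case
      by (rule image_eqI[OF _ mpoly_in_minus[OF p(1)]])
         (simp only: p(2) sq_embed_minus from_skew_minus[OF sq_embed_closed[OF p(1)]])
  next
    case (eng_add h1 h2)
    then obtain p q where p: "p \<in> mpoly_in n" "h1 = from_skew n (sq_embed p)"
      and q: "q \<in> mpoly_in n" "h2 = from_skew n (sq_embed q)" by blast
    show ?case
      by (rule image_eqI[OF _ mpoly_in_add[OF p(1) q(1)]])
         (simp only: p(2) q(2) sq_embed_add from_skew_hom sq_embed_closed[OF p(1)] sq_embed_closed[OF q(1)])
  next
    case (eng_mult h1 h2)
    then obtain p q where p: "p \<in> mpoly_in n" "h1 = from_skew n (sq_embed p)"
      and q: "q \<in> mpoly_in n" "h2 = from_skew n (sq_embed q)" by blast
    show ?case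
      by (rule image_eqI[OF _ mpoly_in_mult[OF p(1) q(1)]])
         (simp only: p(2) q(2) sq_embed_mult from_skew_hom sq_embed_closed[OF p(1)] sq_embed_closed[OF q(1)])
  qed
  moreover have "from_skew n (sq_embed p) \<in> ?G" if p: "p \<in> mpoly_in n" for p
  proof -
    from p have "Poly_Mapping.keys p \<subseteq> exps_in n" by simp
    then have "p \<in> mpoly_in n \<and> from_skew n (sq_embed p) \<in> ?G"
    proof (induction rule: frag_induction)
      case zero
      show ?case using zero_in_generate by (simp add: from_skew_hom)
    next
      case (one m)
      obtain w where w: "m = word_exp w" using word_exp_surj by metis
      with one have "w \<in> lists {1..n}" by (simp add: exps_in_word_exp)
      then have "frag_of (word_exp w) \<in> mpoly_in n \<and> from_skew n (sq_embed (frag_of (word_exp w))) \<in> ?G"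
      proof (induction w)
        case Nil
        show ?case using generate_ring.one[of "odd_pol n"] by (simp add: from_skew_hom)
      next
        case (Cons i w)
        have eq: "frag_of (word_exp (i # w)) = mpoly_var i * frag_of (word_exp w)"
          by (simp add: mpoly_var_def mult_single)
        have i: "mpoly_var i \<in> mpoly_in n"
          using Cons.hyps(1) by (rule mpoly_var_in)
        have w: "frag_of (word_exp w) \<in> mpoly_in n" using Cons.IH by blast
        have "from_skew n (sq_embed (mpoly_var i * frag_of (word_exp w))) =
            sq_var n i \<otimes>\<^bsub>odd_pol n\<^esub> from_skew n (sq_embed (frag_of (word_exp w)))"
          by (simp only: sq_embed_mult from_skew_hom sq_embed_closed[OF i] sq_embed_closed[OF w]
              sq_var_eq_from_skew[OF Cons.hyps(1)])
        moreover have "sq_var n i \<in> ?G" using Cons.hyps(1) by (intro generate_ring.incl) blast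
        ultimately show ?case
          unfolding eq using mpoly_in_mult[OF i w] Cons.IH by (metis generate_ring.eng_mult)
      qed
      then show ?case by (simp add: w)
    next
      case (diff p q)
      then have p: "p \<in> mpoly_in n" and q: "q \<in> mpoly_in n" by blast+
      have "from_skew n (sq_embed (p + - q)) =
          from_skew n (sq_embed p) \<oplus>\<^bsub>odd_pol n\<^esub> \<ominus>\<^bsub>odd_pol n\<^esub> from_skew n (sq_embed q)"
        by (simp only: sq_embed_add sq_embed_minus from_skew_hom from_skew_minus
            sq_embed_closed[OF p] sq_embed_closed[OF q] skew_pol_minus)
      then have "from_skew n (sq_embed (p - q)) \<in> ?G"
        using diff by (simp add: generate_ring.eng_add generate_ring.a_inv)
      with mpoly_in_diff[OF p q] show ?case by blast
    qed
    then show ?thesis ..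
  qed
  ultimately show ?thesis by (auto simp: sq_subalg_def)
qed

lemma sq_subalg_simps:
  "f \<otimes>\<^bsub>sq_subalg n\<^esub> g = f \<otimes>\<^bsub>odd_pol n\<^esub> g" "f \<oplus>\<^bsub>sq_subalg n\<^esub> g = f \<oplus>\<^bsub>odd_pol n\<^esub> g"
  "\<one>\<^bsub>sq_subalg n\<^esub> = \<one>\<^bsub>odd_pol n\<^esub>"
  by (simp_all add: sq_subalg_def)

lemma from_sq_hom:
  assumes "p \<in> mpoly_in n" "q \<in> mpoly_in n"
  shows "from_sq n (p * q) = from_sq n p \<otimes>\<^bsub>odd_pol n\<^esub> from_sq n q"
    and "from_sq n (p + q) = from_sq n p \<oplus>\<^bsub>odd_pol n\<^esub> from_sq n q"
    and "from_sq n 1 = \<one>\<^bsub>odd_pol n\<^esub>"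
  by (simp_all only: sq_embed_mult sq_embed_add sq_embed_one from_skew_hom
      sq_embed_closed[OF assms(1)] sq_embed_closed[OF assms(2)])

lemma from_sq_closed: "p \<in> mpoly_in n \<Longrightarrow> from_sq n p \<in> carrier (odd_pol n)"
  by (intro from_skew_closed sq_embed_closed)

lemma from_sq_eq_iff:
  "p \<in> mpoly_in n \<Longrightarrow> q \<in> mpoly_in n \<Longrightarrow> from_sq n p = from_sq n q \<longleftrightarrow> p = q"
  by (metis sq_embed_closed sq_embed_eq_iff to_skew_from_skew)

lemma perm_act_in:
  assumes "\<pi> permutes {1..n}" "p \<in> mpoly_in n"
  shows "perm_act \<pi> p \<in> mpoly_in n"
proof -
  have 1: "perm_exp \<pi> m \<in> exps_in n" if "m \<in> exps_in n" for m
  proof -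
    obtain w where w: "m = word_exp w" using word_exp_surj by metis
    with that have "w \<in> lists {1..n}" by (simp only: exps_in_word_exp)
    then have "map \<pi> w \<in> lists {1..n}" using permutes_in_image[OF assms(1)] by (auto simp del: atLeastAtMost_iff)
    then show ?thesis by (simp only: w perm_exp_word_exp exps_in_word_exp)
  qed
  from assms(2) have "Poly_Mapping.keys p \<subseteq> exps_in n" by simp
  then show ?thesis
    by (induction rule: frag_induction)
       (simp_all add: 1 perm_act_diff mpoly_in_diff[simplified])
qed

lemma perm_act_var: "perm_act \<pi> (mpoly_var i) = mpoly_var (\<pi> i)"
  by (simp add: mpoly_var_def perm_exp_single)

text \<open>On the subalgebra of the squares the action is the commutative one, transported by the embedding
\<open>t\<^sub>i \<mapsto> x\<^sub>i\<^sup>2\<close>; a homomorphism is determined by its values on the squares.\<close>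

lemma sq_action_from_sq:
  assumes \<pi>: "\<pi> permutes {1..n}" and p: "p \<in> mpoly_in n"
  shows "sq_action n \<pi> (from_sq n p) = from_sq n (perm_act \<pi> p)"
proof -
  interpret ring "odd_pol n" by (rule ring_odd_pol)
  let ?C = "carrier (sq_subalg n)"
  let ?P = "\<lambda>\<phi>. \<phi> \<in> extensional ?C \<and> \<phi> \<in> ring_hom (sq_subalg n) (sq_subalg n) \<and>
     (\<forall>i\<in>{1..n}. \<phi> (sq_var n i) = sq_var n (\<pi> i))"
  let ?\<phi> = "restrict (\<lambda>f. from_sq n (perm_act \<pi> (inv_into (mpoly_in n) (from_sq n) f))) ?C"
  have inj: "inj_on (from_sq n) (mpoly_in n)"
    by (rule inj_onI) (simp only: from_sq_eq_iff)
  have C: "from_sq n p \<in> ?C" if "p \<in> mpoly_in n" for p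
    unfolding carrier_sq_subalg using that by (rule imageI)
  have \<phi>: "?\<phi> (from_sq n p) = from_sq n (perm_act \<pi> p)" if "p \<in> mpoly_in n" for p
    using C[OF that] inv_into_f_f[OF inj that] by simp
  have var: "sq_var n i = from_sq n (mpoly_var i)" "sq_var n (\<pi> i) = from_sq n (mpoly_var (\<pi> i))"
    if "i \<in> {1..n}" for i
    using that permutes_in_image[OF \<pi>] by (simp_all only: sq_var_eq_from_skew)
  have "sq_action n \<pi> = ?\<phi>"
    unfolding sq_action_def
  proof (rule the_equality)
    have "?\<phi> \<in> ring_hom (sq_subalg n) (sq_subalg n)"
    proof (rule ring_hom_memI)
      fix f assume "f \<in> ?C"
      then obtain p where p: "p \<in> mpoly_in n" "f = from_sq n p" unfolding carrier_sq_subalg by blast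
      show "?\<phi> f \<in> ?C" unfolding p(2) \<phi>[OF p(1)] by (rule C[OF perm_act_in[OF \<pi> p(1)]])
      fix g assume "g \<in> ?C"
      then obtain q where q: "q \<in> mpoly_in n" "g = from_sq n q" unfolding carrier_sq_subalg by blast
      note pq = perm_act_in[OF \<pi> p(1)] perm_act_in[OF \<pi> q(1)]
      show "?\<phi> (f \<otimes>\<^bsub>sq_subalg n\<^esub> g) = ?\<phi> f \<otimes>\<^bsub>sq_subalg n\<^esub> ?\<phi> g"
        unfolding p(2) q(2) sq_subalg_simps from_sq_hom[OF p(1) q(1), symmetric]
          \<phi>[OF p(1)] \<phi>[OF q(1)] \<phi>[OF mpoly_in_mult[OF p(1) q(1)]]
        by (simp only: perm_act_mult from_sq_hom[OF pq])
      show "?\<phi> (f \<oplus>\<^bsub>sq_subalg n\<^esub> g) = ?\<phi> f \<oplus>\<^bsub>sq_subalg n\<^esub> ?\<phi> g"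
        unfolding p(2) q(2) sq_subalg_simps from_sq_hom[OF p(1) q(1), symmetric]
          \<phi>[OF p(1)] \<phi>[OF q(1)] \<phi>[OF mpoly_in_add[OF p(1) q(1)]]
        by (simp only: perm_act_add from_sq_hom[OF pq])
    next
      show "?\<phi> \<one>\<^bsub>sq_subalg n\<^esub> = \<one>\<^bsub>sq_subalg n\<^esub>"
        unfolding sq_subalg_simps from_sq_hom(3)[OF mpoly_in_one mpoly_in_one, symmetric]
          \<phi>[OF mpoly_in_one] perm_act_one ..
    qed
    moreover have "?\<phi> (sq_var n i) = sq_var n (\<pi> i)" if i: "i \<in> {1..n}" for i
      unfolding var[OF i] \<phi>[OF mpoly_var_in[OF i]] perm_act_var ..
    ultimately show "?P ?\<phi>" by blast
  next
    fix \<psi> assume \<psi>: "?P \<psi>"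
    then have hom: "\<psi> \<in> ring_hom (sq_subalg n) (sq_subalg n)" by blast
    have car: "\<psi> (from_sq n p) \<in> carrier (odd_pol n)" if "p \<in> mpoly_in n" for p
    proof -
      have "\<psi> (from_sq n p) \<in> ?C" by (rule ring_hom_closed[OF hom C[OF that]])
      then obtain q where "q \<in> mpoly_in n" "\<psi> (from_sq n p) = from_sq n q"
        unfolding carrier_sq_subalg by (rule imageE)
      then show ?thesis by (simp only: from_sq_closed)
    qed
    have "to_skew (\<psi> (from_sq n p)) = sq_embed (perm_act \<pi> p)" if "p \<in> mpoly_in n" for p
      using that
    proof (rule mpoly_hom_unique)
      fix p q assume p: "p \<in> mpoly_in n" and q: "q \<in> mpoly_in n"
      show "to_skew (\<psi> (from_sq n (p + q))) = to_skew (\<psi> (from_sq n p)) + to_skew (\<psi> (from_sq n q))"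
        using ring_hom_add[OF hom C[OF p] C[OF q]] to_skew_hom(2)[OF car[OF p] car[OF q]]
        by (simp only: from_sq_hom(2)[OF p q] sq_subalg_simps)
      show "to_skew (\<psi> (from_sq n (p * q))) = to_skew (\<psi> (from_sq n p)) * to_skew (\<psi> (from_sq n q))"
        using ring_hom_mult[OF hom C[OF p] C[OF q]] to_skew_hom(1)[OF car[OF p] car[OF q]]
        by (simp only: from_sq_hom(1)[OF p q] sq_subalg_simps)
    next
      show "to_skew (\<psi> (from_sq n 1)) = 1"
        using ring_hom_one[OF hom]
        by (simp only: from_sq_hom(3)[OF mpoly_in_one mpoly_in_one] sq_subalg_simps to_skew_hom)
    next
      fix i assume i: "i \<in> {1..n}"
      have "\<psi> (sq_var n i) = sq_var n (\<pi> i)" using \<psi> i by blast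
      moreover have "\<pi> i \<in> {1..n}" using i permutes_in_image[OF \<pi>] by blast
      ultimately show "to_skew (\<psi> (from_sq n (mpoly_var i))) = sq_embed (perm_act \<pi> (mpoly_var i))"
        by (simp only: perm_act_var to_skew_sq_var flip: var(1)[OF i])
    qed (simp_all add: perm_act_add perm_act_mult sq_embed_add sq_embed_mult)
    then have "\<psi> (from_sq n p) = ?\<phi> (from_sq n p)" if "p \<in> mpoly_in n" for p
      using that \<phi>[OF that] car[OF that] by (metis from_skew_to_skew)
    then have "\<psi> f = ?\<phi> f" if "f \<in> ?C" for f
      using that unfolding carrier_sq_subalg by blast
    moreover have "\<psi> \<in> extensional ?C" using \<psi> by blast
    ultimately show "\<psi> = ?\<phi>"
      by (intro extensionalityI[of _ ?C]) simp_all
  qed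
  then show ?thesis using \<phi>[OF p] by simp
qed

lemma sq_invariants_eq:
  "sq_invariants n = from_sq n ` {p \<in> mpoly_in n. \<forall>\<pi>. \<pi> permutes {1..n} \<longrightarrow> perm_act \<pi> p = p}"
proof -
  have "(\<forall>\<pi>. \<pi> permutes {1..n} \<longrightarrow> sq_action n \<pi> (from_sq n p) = from_sq n p) \<longleftrightarrow>
      (\<forall>\<pi>. \<pi> permutes {1..n} \<longrightarrow> perm_act \<pi> p = p)" if p: "p \<in> mpoly_in n" for p
    using sq_action_from_sq[OF _ p] from_sq_eq_iff[OF perm_act_in[OF _ p] p] by metis
  then show ?thesis unfolding sq_invariants_def carrier_sq_subalg by blast
qed

lemma spinB_sym_eq_image:
  assumes n: "n \<ge> 1"
  shows "spinB_sym n = from_sq n ` {p \<in> mpoly_in n. \<forall>i\<in>{1..<n}. perm_act (adj i) p = p}"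
proof (intro subset_antisym subsetI)
  fix f assume f: "f \<in> spinB_sym n"
  then have fc: "f \<in> carrier (odd_pol n)" by (simp add: spinB_sym_eq)
  from f obtain p where p: "p \<in> mpoly_in n" "to_skew f = sq_embed p" "\<forall>i\<in>{1..<n}. perm_act (adj i) p = p"
    using skew_kernel[OF n to_skew_closed[OF fc]] unfolding spinB_sym_eq by blast
  then have "f = from_sq n p" using from_skew_to_skew[OF fc] by simp
  with p show "f \<in> from_sq n ` {p \<in> mpoly_in n. \<forall>i\<in>{1..<n}. perm_act (adj i) p = p}" by blast
next
  fix f assume "f \<in> from_sq n ` {p \<in> mpoly_in n. \<forall>i\<in>{1..<n}. perm_act (adj i) p = p}"
  then obtain p where p: "p \<in> mpoly_in n" "f = from_sq n p" "\<forall>i\<in>{1..<n}. perm_act (adj i) p = p" by blast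
  have "to_skew f = sq_embed p" using to_skew_from_skew[OF sq_embed_closed[OF p(1)]] p(2) by simp
  then show "f \<in> spinB_sym n"
    using skew_kernel[OF n sq_embed_closed[OF p(1)]] p from_sq_closed[OF p(1)]
    unfolding spinB_sym_eq by auto
qed

text \<open>Invariance under adjacent transpositions yields a polynomial in the \<open>e\<^sub>k\<close>, and such polynomials are
invariant under all permutations.  This closes the circle without a statement on generators of the
symmetric group.\<close>

lemma adj_symmetric_eq:
  "{p \<in> mpoly_in n. \<forall>i\<in>{1..<n}. perm_act (adj i) p = p} = elem_hom n ` mpoly_in n"
  "{p \<in> mpoly_in n. \<forall>\<pi>. \<pi> permutes {1..n} \<longrightarrow> perm_act \<pi> p = p} = elem_hom n ` mpoly_in n"
proof -
  let ?A = "{p \<in> mpoly_in n. \<forall>i\<in>{1..<n}. perm_act (adj i) p = p}"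
  let ?B = "{p \<in> mpoly_in n. \<forall>\<pi>. \<pi> permutes {1..n} \<longrightarrow> perm_act \<pi> p = p}"
  have "adj i permutes {1..n}" if "i \<in> {1..<n}" for i
    using that by (intro permutes_swap_id) auto
  then have BA: "?B \<subseteq> ?A" by blast
  have AX: "?A \<subseteq> elem_hom n ` mpoly_in n"
    using symmetric_imp_elem_hom by blast
  have XB: "elem_hom n ` mpoly_in n \<subseteq> ?B"
  proof (rule image_subsetI)
    fix q show "elem_hom n q \<in> ?B"
      using elem_hom_in[of n q] perm_act_elem_hom[of _ n q] by simp
  qed
  show "?A = elem_hom n ` mpoly_in n"
    by (rule subset_antisym[OF AX subset_trans[OF XB BA]])
  show "?B = elem_hom n ` mpoly_in n"
    by (rule subset_antisym[OF subset_trans[OF BA AX] XB])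
qed

lemma to_skew_spinB_elem:
  "spinB_elem n k \<in> carrier (odd_pol n) \<and> to_skew (spinB_elem n k) = sq_embed (elem_sym n k)"
proof -
  interpret ring "odd_pol n" by (rule ring_odd_pol)
  let ?F = "\<lambda>S. foldr (\<lambda>i p. sq_var n i \<otimes>\<^bsub>odd_pol n\<^esub> p) (sorted_list_of_set S) \<one>\<^bsub>odd_pol n\<^esub>"
  have 1: "foldr (\<lambda>i p. sq_var n i \<otimes>\<^bsub>odd_pol n\<^esub> p) w \<one>\<^bsub>odd_pol n\<^esub> \<in> carrier (odd_pol n) \<and>
     to_skew (foldr (\<lambda>i p. sq_var n i \<otimes>\<^bsub>odd_pol n\<^esub> p) w \<one>\<^bsub>odd_pol n\<^esub>) = sq_embed (frag_of (word_exp w))"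
    if "w \<in> lists {1..n}" for w
    using that
  proof (induction w)
    case Nil
    show ?case by (simp add: to_skew_hom)
  next
    case (Cons i w)
    have "frag_of (word_exp (i # w)) = mpoly_var i * frag_of (word_exp w)"
      by (simp add: mpoly_var_def mult_single)
    with Cons show ?case
      by (simp add: sq_var_closed to_skew_hom to_skew_sq_var sq_embed_mult)
  qed
  have F: "?F S \<in> carrier (odd_pol n)" "to_skew (?F S) = sq_embed (frag_of (set_exp S))"
    if "S \<subseteq> {1..n}" for S
  proof -
    have fin: "finite S" using that finite_subset by blast
    then have "word_exp (sorted_list_of_set S) = set_exp S"
      using distinct_count_atmost_1[of "sorted_list_of_set S"]
      by (intro poly_mapping_eqI) (simp add: lookup_word_exp lookup_set_exp)
    moreover have "sorted_list_of_set S \<in> lists {1..n}" using that fin by auto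
    ultimately show "?F S \<in> carrier (odd_pol n)" "to_skew (?F S) = sq_embed (frag_of (set_exp S))"
      using 1 by simp_all
  qed
  have "finite A \<Longrightarrow> A \<subseteq> Pow {1..n} \<Longrightarrow> finsum (odd_pol n) ?F A \<in> carrier (odd_pol n) \<and>
     to_skew (finsum (odd_pol n) ?F A) = sq_embed (\<Sum>S\<in>A. frag_of (set_exp S))" for A
  proof (induction A rule: finite_induct)
    case empty
    show ?case by (simp add: to_skew_hom)
  next
    case (insert S A)
    then have S: "S \<subseteq> {1..n}" and A: "A \<subseteq> Pow {1..n}" by auto
    have "finsum (odd_pol n) ?F (insert S A) = ?F S \<oplus>\<^bsub>odd_pol n\<^esub> finsum (odd_pol n) ?F A"
      using insert.hyps A F(1) S by (intro finsum_insert) blast+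
    with insert.IH[OF A] insert.hyps F[OF S] show ?case
      by (simp add: to_skew_hom sq_embed_add)
  qed
  from this[of "{S. S \<subseteq> {1..n} \<and> card S = k}"] show ?thesis
    unfolding spinB_elem_def elem_sym_def by (simp add: Collect_mono_iff Pow_def)
qed

theorem theorem3p5:
  fixes n :: nat
  assumes "n \<ge> 1"
  shows "spinB_sym n = sq_invariants n \<and>
    is_polynomial_algebra_on (odd_pol n \<lparr>carrier := spinB_sym n\<rparr>) n (spinB_elem n)"
proof
  have image: "spinB_sym n = from_sq n ` elem_hom n ` mpoly_in n"
    using spinB_sym_eq_image[OF assms] unfolding adj_symmetric_eq .
  then show "spinB_sym n = sq_invariants n"
    unfolding sq_invariants_eq adj_symmetric_eq .
  let ?\<phi> = "\<lambda>q. from_sq n (elem_hom n q)"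
  have carrier: "carrier (int_mpoly_ring n) = mpoly_in n"
    by (auto simp: int_mpoly_ring_def exps_in_def)
  have "?\<phi> \<in> ring_iso (int_mpoly_ring n) (odd_pol n \<lparr>carrier := spinB_sym n\<rparr>)"
  proof (rule ring_iso_memI)
    fix p assume "p \<in> carrier (int_mpoly_ring n)"
    then have p: "p \<in> mpoly_in n" unfolding carrier .
    then show "?\<phi> p \<in> carrier (odd_pol n \<lparr>carrier := spinB_sym n\<rparr>)"
      unfolding image by simp
    fix q assume "q \<in> carrier (int_mpoly_ring n)"
    show "?\<phi> (p \<otimes>\<^bsub>int_mpoly_ring n\<^esub> q) = ?\<phi> p \<otimes>\<^bsub>odd_pol n \<lparr>carrier := spinB_sym n\<rparr>\<^esub> ?\<phi> q"
      using from_sq_hom(1)[OF elem_hom_in elem_hom_in] by (simp add: int_mpoly_ring_def elem_hom_mult)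
    show "?\<phi> (p \<oplus>\<^bsub>int_mpoly_ring n\<^esub> q) = ?\<phi> p \<oplus>\<^bsub>odd_pol n \<lparr>carrier := spinB_sym n\<rparr>\<^esub> ?\<phi> q"
      using from_sq_hom(2)[OF elem_hom_in elem_hom_in] by (simp add: int_mpoly_ring_def elem_hom_add)
  next
    show "?\<phi> \<one>\<^bsub>int_mpoly_ring n\<^esub> = \<one>\<^bsub>odd_pol n \<lparr>carrier := spinB_sym n\<rparr>\<^esub>"
      by (simp add: int_mpoly_ring_def from_skew_hom)
    have "inj_on ?\<phi> (mpoly_in n)"
    proof (rule inj_onI)
      fix p q assume pq: "p \<in> mpoly_in n" "q \<in> mpoly_in n" "?\<phi> p = ?\<phi> q"
      then have "elem_hom n (p - q) = 0"
        using from_sq_eq_iff[OF elem_hom_in elem_hom_in] by (simp add: elem_hom_diff)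
      with mpoly_in_diff[OF pq(1,2)] have "p - q = 0" by (rule elem_hom_eq_0)
      then show "p = q" by simp
    qed
    then show "bij_betw ?\<phi> (carrier (int_mpoly_ring n)) (carrier (odd_pol n \<lparr>carrier := spinB_sym n\<rparr>))"
      unfolding carrier image by (simp add: bij_betw_def image_image)
  qed
  then show "is_polynomial_algebra_on (odd_pol n \<lparr>carrier := spinB_sym n\<rparr>) n (spinB_elem n)"
    unfolding is_polynomial_algebra_on_def
  proof (rule bexI[rotated], intro ballI)
    fix k assume k: "k \<in> {1..n}"
    show "?\<phi> (mpoly_var k) = spinB_elem n k"
    proof -
      have "from_skew n (to_skew (spinB_elem n k)) = spinB_elem n k"
        by (rule from_skew_to_skew) (simp only: to_skew_spinB_elem)
      then show ?thesis by (simp only: to_skew_spinB_elem elem_hom_var[OF k])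
    qed
  qed
qed

end
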